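(* Let $q$ be a prime power and let $m,t$ be positive integers such that $N_q^*(m,t)\neq 0$. (a) Let $J=\{j\in\mathbb{N} \mid j \text{ divides } m,\ \gcd(\frac{q^m-1}{q^{m/j}-1},t)=1\}$. Then $$N_q^*(m,t)=\frac{\varphi(t)}{mt}\sum_{j\in J}\mu(j)(q^{m/j}-1).$$ (b) We have $$\frac{\varphi(t)(q^m-1)}{t(m+1)}\le N_q^*(m,t)\le \frac{\varphi(t)(q^m-1)}{tm}.$$
   Context: $\mathbb{N}$ is the set of positive integers and $\mathbb{F}_q$ is the finite field with $q$ elements. For $t\in\mathbb{N}$, a polynomial $f\in\mathbb{F}_q[x]$ is called $t$-hyper-irreducible if $f(x^t)$ is irreducible over $\mathbb{F}_q$. $N_q^*(m,t)$ denotes the number of all monic $t$-hyper-irreducible polynomials $f(x)\neq x$ of degree $m$ over $\mathbb{F}_q$. $\varphi$ is Euler's totient function and $\mu$ is the Moebius function. *)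

theory Defs
  imports
    "HOL-Library.Cardinality"
    "HOL-Computational_Algebra.Computational_Algebra"
    "HOL-Number_Theory.Totient"
    "HOL-Number_Theory.Prime_Powers"
begin

definition moebius_mu :: "nat \<Rightarrow> int" where
  "moebius_mu n = (if squarefree n then (-1) ^ card (prime_factors n) else 0)"

(* monom 1 t is x^t, so the composition is f(x^t). *)
definition hyper_irreducible :: "nat \<Rightarrow> 'a::finite_field poly \<Rightarrow> bool" where
  "hyper_irreducible t f \<longleftrightarrow> irreducible (f \<circ>\<^sub>p monom 1 t)"

(* N_q^*(m,t), where the finite field with q elements is the type 'a. *)
definition N_star :: "'a::finite_field itself \<Rightarrow> nat \<Rightarrow> nat \<Rightarrow> nat" where
  "N_star _ m t =
     card {f :: 'a poly. lead_coeff f = 1 \<and> degree f = m \<and> hyper_irreducible t f \<and> f \<noteq> [:0, 1:]}"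

end

theory Submission
  imports "HOL-Algebra.Algebraic_Closure_Type" Defs
begin

text \<open>
  Work in the algebraic closure of the field with \<open>q\<close> elements and let the degree of \<open>x\<close> be the least
  \<open>n > 0\<close> with \<open>x ^ q ^ n = x\<close>. Taking roots, \<open>m\<close> times the number of hyper-irreducible polynomials is
  the number of nonzero \<open>x\<close> of degree \<open>m\<close> all of whose \<open>t\<close>-th roots have degree \<open>m t\<close>. For such an \<open>x\<close>
  every prime \<open>p\<close> dividing \<open>t\<close> divides \<open>q ^ m - 1\<close> and \<open>x\<close> is not a \<open>p\<close>-th power in the field with
  \<open>q ^ m\<close> elements, and \<open>4\<close> divides \<open>q ^ m - 1\<close> if it divides \<open>t\<close>; lifting the exponent shows that
  these conditions also suffice. If at least one such \<open>x\<close> exists, only the condition on \<open>p\<close>-th powers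
  depends on \<open>x\<close>. The subfield with \<open>q ^ d\<close> elements contains \<open>\<phi>(t) (q ^ d - 1) / t\<close> elements that
  satisfy it, or none if some prime divides both \<open>t\<close> and \<open>(q ^ m - 1) / (q ^ d - 1)\<close>, and Moebius
  inversion over the degrees gives (a). In (b) the upper bound forgets the degree, and the lower bound
  estimates the terms with \<open>j \<noteq> 1\<close> in (a).
\<close>

section \<open>Prime powers dividing geometric sums\<close>

lemma geometric_sum_nat: "(Q - 1) * (\<Sum>i<k. Q ^ i) = Q ^ k - (1::nat)"
proof (cases "Q = 0")
  case False
  have "int ((Q - 1) * (\<Sum>i<k. Q ^ i)) = int (Q ^ k - 1)"
    using False power_diff_1_eq[of "int Q" k] by (simp add: of_nat_diff Suc_leI)
  thus ?thesis by (metis of_nat_eq_iff)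
qed (cases k; simp)

lemma cong_geometric_sum:
  assumes "[Q = 1] (mod p)"
  shows "[(\<Sum>i<k. Q ^ i) = k] (mod (p::nat))"
proof -
  have "[(\<Sum>i<k. Q ^ i) = (\<Sum>i<k. 1)] (mod p)"
    using assms by (intro cong_sum) (metis cong_pow power_one)
  thus ?thesis by simp
qed

text \<open>The exponents below \<open>k * l\<close> fall into \<open>k\<close> blocks of length
  \<open>l\<close>, each a power of \<open>Q ^ l\<close> times the short sum.\<close>

lemma geometric_sum_mult:
  "(\<Sum>i<k * l. Q ^ i) = (\<Sum>i<k. (Q ^ l) ^ i) * (\<Sum>i<l. (Q::nat) ^ i)"
proof (induction k)
  case (Suc k)
  have "(\<Sum>i<l + k * l. Q ^ i) = (\<Sum>i<k * l. Q ^ i) + (\<Sum>i=k*l..<l + k*l. Q ^ i)"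
    by (metis add.commute le_add2 lessThan_atLeast0 sum.atLeastLessThan_concat zero_le)
  also have "(\<Sum>i=k*l..<l + k*l. Q ^ i) = (\<Sum>i<l. Q ^ (i + k * l))"
    using sum.shift_bounds_nat_ivl[of "\<lambda>i. Q ^ i" 0 "k * l" l] by (simp add: lessThan_atLeast0)
  also have "\<dots> = (Q ^ l) ^ k * (\<Sum>i<l. Q ^ i)"
    by (simp add: power_add sum_distrib_left sum_distrib_right mult.commute flip: power_mult)
  finally show ?case using Suc by (simp add: algebra_simps)
qed simp

text \<open>For odd \<open>p\<close> write Q = 1 + p c. Modulo p^2 the i-th power is 1 + p c i, and
  since \<open>p\<close> divides the sum of all i < p, the whole sum is \<open>p\<close>. For
  \<open>p = 2\<close> the sum is \<open>Q + 1\<close>, which is 2 modulo 4.\<close>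

lemma geometric_sum_prime_not_square_dvd:
  assumes "prime p" "[Q = 1] (mod p)" "p = 2 \<longrightarrow> [Q = 1] (mod 4)"
  shows "\<not> p ^ 2 dvd (\<Sum>i<p. Q ^ i :: nat)"
proof (cases "p = 2")
  case True
  have "(\<Sum>i<p. Q ^ i) = Q + 1" using True by (simp add: numeral_2_eq_2)
  moreover have "[Q + 1 = 1 + 1] (mod 4)" using assms True by (metis cong_add_rcancel_nat)
  ultimately show ?thesis using True by (auto simp: cong_def dvd_eq_mod_eq_0)
next
  case False
  hence odd: "odd p" using assms(1) prime_odd_nat prime_ge_2_nat[of p] by fastforce
  have p3: "p > 2" using False prime_ge_2_nat[OF assms(1)] by simp
  obtain c :: int where c: "int Q = 1 + int p * c"
    using assms(2) by (metis cong_iff_lin cong_int_iff cong_sym of_nat_1)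
  have *: "[(1 + int p * c) ^ i = 1 + int p * c * int i] (mod (int p)\<^sup>2)" for i
  proof (induction i)
    case (Suc i)
    have "[(1 + int p * c) ^ Suc i = (1 + int p * c) * (1 + int p * c * int i)] (mod (int p)\<^sup>2)"
      using Suc by (simp add: cong_scalar_left)
    also have "(1 + int p * c) * (1 + int p * c * int i)
        = 1 + int p * c * int (Suc i) + (int p)\<^sup>2 * (c * c * int i)"
      by (simp add: algebra_simps power2_eq_square)
    also have "[\<dots> = 1 + int p * c * int (Suc i)] (mod (int p)\<^sup>2)"
      by (simp add: cong_def)
    finally show ?case .
  qed auto
  have "[(\<Sum>i<p. int Q ^ i) = (\<Sum>i<p. 1 + int p * c * int i)] (mod (int p)\<^sup>2)"
    unfolding c by (intro cong_sum *)
  also have "(\<Sum>i<p. 1 + int p * c * int i) = int p + int p * c * (\<Sum>i<p. int i)"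
    by (simp add: sum.distrib sum_distrib_left)
  also have "(\<Sum>i<p. int i) = int p * (int (p - 1) div 2)"
  proof -
    have "(\<Sum>i<p. i) = p * (p - 1) div 2"
      by (metis Sum_Ico_nat lessThan_atLeast0 mult_0 diff_zero)
    also have "\<dots> = p * ((p - 1) div 2)" using odd by (simp add: div_mult_swap)
    finally have "int (\<Sum>i<p. i) = int (p * ((p - 1) div 2))" by (rule arg_cong)
    thus ?thesis by (simp add: zdiv_int)
  qed
  also have "int p + int p * c * (int p * (int (p - 1) div 2))
      = int p + (int p)\<^sup>2 * (c * (int (p - 1) div 2))"
    by (simp add: algebra_simps power2_eq_square)
  also have "[\<dots> = int p] (mod (int p)\<^sup>2)" by (simp add: cong_def)
  finally have **: "[int (\<Sum>i<p. Q ^ i) = int p] (mod (int p)\<^sup>2)" by simp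
  show ?thesis
  proof
    assume "p\<^sup>2 dvd (\<Sum>i<p. Q ^ i)"
    hence "(int p)\<^sup>2 dvd int (\<Sum>i<p. Q ^ i)" by (metis of_nat_dvd_iff of_nat_power)
    hence "(int p)\<^sup>2 dvd int p" using ** cong_dvd_iff cong_sym by metis
    hence "p\<^sup>2 dvd p" by (metis of_nat_dvd_iff of_nat_power)
    hence "p * p \<le> p" using p3 by (auto simp: power2_eq_square dest: dvd_imp_le)
    thus False using p3 by simp
  qed
qed

text \<open>One direction of lifting the exponent. Modulo \<open>p\<close> the sum is
  \<open>k\<close>, so k = l p. Splitting into blocks of length \<open>p\<close> leaves a factor
  with exactly one \<open>p\<close>, and induction applies to \<open>Q ^ p\<close> and
  \<open>l\<close>.\<close>

lemma prime_power_dvd_geometric_sum: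
  assumes "prime p" "[Q = 1] (mod p)" "p = 2 \<and> b \<ge> 2 \<longrightarrow> [Q = 1] (mod 4)"
    and "p ^ b dvd (\<Sum>i<k. Q ^ i :: nat)"
  shows "p ^ b dvd k"
  using assms(2-)
proof (induction b arbitrary: Q k)
  case (Suc b)
  have "p dvd (\<Sum>i<k. Q ^ i)" using dvd_trans[OF _ Suc.prems(3), of p] by simp
  hence "p dvd k" using cong_geometric_sum[OF Suc.prems(1)] cong_dvd_iff by blast
  then obtain l where l: "k = l * p" by (metis dvdE mult.commute)
  show ?case
  proof (cases "b = 0")
    case True thus ?thesis using \<open>p dvd k\<close> by simp
  next
    case False
    \<comment> \<open>The exponent is \<open>Suc b\<close> with \<open>b\<close> nonzero, hence at
      least 2, so the condition modulo 4 is available.\<close>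
    hence 4: "p = 2 \<longrightarrow> [Q = 1] (mod 4)" using Suc.prems by auto
    define S where "S = (\<Sum>i<p. Q ^ i)"
    have "[S = p] (mod p)" using cong_geometric_sum[OF Suc.prems(1)] by (simp add: S_def)
    hence "p dvd S" by (simp add: cong_def dvd_eq_mod_eq_0)
    then obtain u where u: "S = p * u" ..
    have "\<not> p dvd u"
      using geometric_sum_prime_not_square_dvd[OF assms(1) Suc.prems(1) 4] u
      by (auto simp: S_def power2_eq_square)
    hence "coprime (p ^ b) u" using assms(1) by (simp add: prime_imp_coprime)
    have "p * p ^ b dvd (\<Sum>i<l. (Q ^ p) ^ i) * (p * u)"
      using Suc.prems(3) geometric_sum_mult[of Q l p] by (simp add: l u flip: S_def)
    hence "p ^ b dvd (\<Sum>i<l. (Q ^ p) ^ i) * u"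
      using prime_gt_0_nat[OF assms(1)] by (simp add: mult.left_commute)
    hence "p ^ b dvd (\<Sum>i<l. (Q ^ p) ^ i)"
      using \<open>coprime (p ^ b) u\<close> by (simp add: coprime_dvd_mult_left_iff)
    moreover have "[Q ^ p = 1] (mod p)" using Suc.prems(1) by (metis cong_pow power_one)
    moreover have "p = 2 \<and> b \<ge> 2 \<longrightarrow> [Q ^ p = 1] (mod 4)" using 4 by (metis cong_pow power_one)
    ultimately have "p ^ b dvd l" using Suc.IH by blast
    thus ?thesis by (simp add: l mult.commute)
  qed
qed simp

section \<open>The Moebius function and its divisor sums\<close>

lemma moebius_mu_prime_mult:
  assumes "prime p" "\<not> p dvd j" "j > 0"
  shows "moebius_mu (p * j) = - moebius_mu j"
proof -
  have cop: "coprime p j" using assms by (simp add: prime_imp_coprime)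
  have "squarefree (p * j) \<longleftrightarrow> squarefree j"
    using squarefree_mult_coprime[OF cop] squarefree_prime[OF assms(1)] squarefree_multD(2) by blast
  moreover have "prime_factors (p * j) = insert p (prime_factors j)"
    using assms by (simp add: prime_factors_product prime_prime_factors)
  moreover have "p \<notin> prime_factors j" using assms by auto
  ultimately show ?thesis by (simp add: moebius_mu_def)
qed

lemma moebius_mu_eq_0:
  assumes "prime p" "p * p dvd j"
  shows "moebius_mu j = 0"
proof -
  have "\<not> squarefree j" using assms by (auto simp: squarefree_def power2_eq_square not_prime_unit)
  thus ?thesis by (simp add: moebius_mu_def)
qed

lemma moebius_mu_1 [simp]: "moebius_mu (Suc 0) = 1"
  by (simp add: moebius_mu_def)

text \<open>Fix a prime \<open>p\<close> dividing \<open>n\<close>. Divisors divisible by p^2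
  contribute 0, and the others pair up as \<open>j\<close> and \<open>p * j\<close> with opposite
  signs.\<close>

lemma sum_moebius_mu_divisors:
  assumes "n > 0"
  shows "(\<Sum>j | j dvd n. moebius_mu j) = (if n = 1 then 1 else 0)"
proof (cases "n = 1")
  case False
  then obtain p where p: "prime p" "p dvd n" using prime_factor_nat by blast
  define A where "A = {j. p * j dvd n \<and> \<not> p dvd j}"
  define C where "C = {j. j dvd n \<and> p * p dvd j}"
  have fin: "finite {j. j dvd n}" using assms by simp
  have p0: "p > 0" using p prime_gt_0_nat by blast
  have "A \<subseteq> {j. j dvd n}" by (auto simp: A_def dest: dvd_mult_right)
  hence fA: "finite A" using fin finite_subset by blast
  have fC: "finite C" using fin by (simp add: C_def)
  have eq: "{j. j dvd n} = (A \<union> (*) p ` A) \<union> C"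
  proof (intro equalityI subsetI)
    fix j assume "j \<in> {j. j dvd n}"
    hence j: "j dvd n" by simp
    consider "\<not> p dvd j" | i where "j = p * i" "\<not> p dvd i" | "p * p dvd j"
      by (metis dvdE dvd_refl mult_dvd_mono)
    thus "j \<in> A \<union> (*) p ` A \<union> C"
    proof cases
      case 1
      hence "coprime p j" using p by (simp add: prime_imp_coprime)
      hence "p * j dvd n" using p j by (simp add: divides_mult)
      thus ?thesis using 1 by (simp add: A_def)
    qed (use j in \<open>auto simp: A_def C_def\<close>)
  qed (auto simp: A_def C_def dest: dvd_mult_right)
  have "(\<Sum>j | j dvd n. moebius_mu j) = sum moebius_mu (A \<union> (*) p ` A) + sum moebius_mu C"
    unfolding eq by (rule sum.union_disjoint) (use fA fC p0 in \<open>auto simp: A_def C_def\<close>)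
  also have "sum moebius_mu C = 0"
    using p by (intro sum.neutral) (auto simp: C_def intro: moebius_mu_eq_0)
  also have "sum moebius_mu (A \<union> (*) p ` A) = sum moebius_mu A + sum moebius_mu ((*) p ` A)"
    by (rule sum.union_disjoint) (use fA in \<open>auto simp: A_def\<close>)
  also have "sum moebius_mu ((*) p ` A) = (\<Sum>j\<in>A. moebius_mu (p * j))"
    using p0 by (subst sum.reindex) (auto simp: inj_on_def)
  also have "\<dots> = (\<Sum>j\<in>A. - moebius_mu j)"
    by (rule sum.cong) (use p assms in \<open>auto simp: A_def intro!: moebius_mu_prime_mult Nat.gr0I\<close>)
  finally show ?thesis using False by (simp add: sum_negf)
qed simp

lemma moebius_mu_prime: "prime p \<Longrightarrow> moebius_mu p = -1"
  using moebius_mu_prime_mult[of p 1] prime_gt_1_nat[of p] by auto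

lemma abs_moebius_mu_le_1: "\<bar>moebius_mu j\<bar> \<le> 1"
  by (simp add: moebius_mu_def)

section \<open>Elementary estimates for the lower bound\<close>

lemma two_mult_le_power:
  assumes "(q :: nat) \<ge> 2"
  shows "2 * d \<le> q ^ d \<or> d = 0"
proof (induction d)
  case (Suc d)
  have "2 * q ^ d \<le> q ^ Suc d" using assms by simp
  moreover have "2 * Suc d \<le> b" if "2 * a \<le> b" "2 * d \<le> a" "d > 0" for a b :: nat
    using that by presburger
  ultimately have "2 * Suc d \<le> q ^ Suc d" if "d > 0" using Suc that by blast
  thus ?case using assms by (cases "d = 0") auto
qed simp

text \<open>The quotient is a sum of \<open>p\<close> powers of \<open>q ^ d\<close>: the first is 1
  and the other p - 1 are at least q^d \<ge> 2 d, while 2 (p - 1) \<ge> p.\<close>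

lemma primepow_power_quotient_bound:
  assumes q: "(q :: nat) \<ge> 2" and d: "d > 0" and p: "p \<ge> 2"
  shows "(p * d + 1) * (q ^ d - 1) \<le> q ^ (p * d) - 1"
proof -
  obtain r where r: "p = Suc (Suc r)" using p by (metis Suc_le_D numeral_2_eq_2 Suc_le_mono)
  have "p * d \<le> Suc r * (2 * d)" by (simp add: r)
  also have "\<dots> \<le> Suc r * q ^ d" using two_mult_le_power[OF q, of d] d by (intro mult_le_mono2) auto
  also have "\<dots> = (\<Sum>i<Suc r. q ^ d)" by simp
  also have "\<dots> \<le> (\<Sum>i<Suc r. (q ^ d) ^ Suc i)"
  proof (rule sum_mono)
    fix i show "q ^ d \<le> (q ^ d) ^ Suc i" using q by (simp add: one_le_power)
  qed
  finally have "p * d + 1 \<le> (\<Sum>i<p. (q ^ d) ^ i)"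
    unfolding r sum.lessThan_Suc_shift[of _ "Suc r"] by simp
  hence "(p * d + 1) * (q ^ d - 1) \<le> (q ^ d - 1) * (\<Sum>i<p. (q ^ d) ^ i)"
    by (subst mult.commute) (rule mult_le_mono2)
  also have "\<dots> = q ^ (p * d) - 1"
    by (simp only: geometric_sum_nat) (simp add: mult.commute flip: power_mult)
  finally show ?thesis .
qed

lemma sum_powers_le:
  assumes "(q :: nat) \<ge> 2"
  shows "(\<Sum>d=1..h. real q ^ d - 1) \<le> 2 * (real q ^ h - 1)"
proof (induction h)
  case (Suc h)
  have "real q ^ Suc h \<ge> 2 * real q ^ h" using assms by simp
  thus ?case using Suc by simp
qed simp

text \<open>Induction from 23 \<le> 2^5 and 15 \<le> 3^3. The thresholds matter: the inequality
  fails for \<open>q = 2\<close>, \<open>h = 4\<close> and for \<open>q = 3\<close>,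
  \<open>h = 2\<close>.\<close>

lemma four_mult_add_three_le_power:
  assumes "(q :: nat) \<ge> 2" "h \<ge> 5 \<or> (h \<ge> 3 \<and> q \<ge> 3)"
  shows "4 * h + 3 \<le> q ^ h"
proof -
  have step: "4 * (c + k) + 3 \<le> q ^ (c + k)" if "4 * c + 3 \<le> q ^ c" "c > 0" for c k
  proof (induction k)
    case (Suc k)
    have "2 * q ^ (c + k) \<le> q ^ (c + Suc k)" using assms(1) by simp
    moreover have "4 * Suc n + 3 \<le> b" if "2 * a \<le> b" "4 * n + 3 \<le> a" "n > 0" for a b n :: nat
      using that by presburger
    ultimately show ?case using Suc that(2) by (metis add_Suc_right add_gr_0)
  qed (use that in simp)
  from assms(2) show ?thesis
  proof
    assume "h \<ge> 5"
    moreover have "(2::nat) ^ 5 \<le> q ^ 5" using assms(1) by (intro power_mono) auto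
    ultimately show ?thesis using step[of 5 "h - 5"] by simp
  next
    assume h: "h \<ge> 3 \<and> q \<ge> 3"
    hence "(3::nat) ^ 3 \<le> q ^ 3" by (intro power_mono) auto
    thus ?thesis using step[of 3 "h - 3"] h by simp
  qed
qed

lemma not_primepow_ge_6:
  assumes "\<not> primepow (m::nat)" "m > 1"
  shows "m = 6 \<or> m \<ge> 10"
proof (rule ccontr)
  assume "\<not> (m = 6 \<or> m \<ge> 10)"
  hence "m = 2 \<or> m = 3 \<or> m = 2 ^ 2 \<or> m = 5 \<or> m = 7 \<or> m = 2 ^ 3 \<or> m = 3 ^ 2"
    using assms(2) by simp linarith
  moreover have "prime (2::nat)" "prime (3::nat)" "prime (5::nat)" "prime (7::nat)" by simp_all
  ultimately show False
    using assms(1) primepow_prime primepow_prime_power by (metis zero_less_numeral)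
qed

text \<open>
  Bounding the terms with \<open>j \<noteq> 1\<close> by \<open>q ^ d - 1\<close> for all \<open>d \<le> m div 2\<close> suffices unless \<open>m\<close> is a
  prime power, where only one such term is nonzero, or \<open>q = 2\<close> and \<open>m = 6\<close>, where the case \<open>J = {1, 2, 3, 6}\<close>
  is an equality that would fail without the term for \<open>6\<close>.
\<close>

lemma sum_moebius_mu_powers_ge:
  fixes q m :: nat
  assumes q: "q \<ge> 2" and m: "m > 0" and J: "J \<subseteq> {j. j dvd m}" "1 \<in> J"
    and six: "q = 2 \<Longrightarrow> m = 6 \<Longrightarrow> 2 \<in> J \<Longrightarrow> 3 \<in> J \<Longrightarrow> 6 \<in> J"
  shows "real m * (real q ^ m - 1)
    \<le> (real m + 1) * (\<Sum>j\<in>J. real_of_int (moebius_mu j) * (real q ^ (m div j) - 1))"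
proof -
  define f where "f j = real_of_int (moebius_mu j) * (real q ^ (m div j) - 1)" for j
  have fin: "finite J" using J(1) m finite_subset by fastforce
  have "sum f J = f 1 + sum f (J - {1})" using J(2) fin by (simp add: sum.remove)
  hence split: "sum f J = real q ^ m - 1 + sum f (J - {1})" by (simp add: f_def)
  \<comment> \<open>The term for \<open>j = 1\<close> is \<open>real q ^ m - 1\<close>; moving
    \<open>m\<close> copies of it to the other side leaves a bound on the remaining terms.\<close>
  have goal: ?thesis if "- ((real m + 1) * sum f (J - {1})) \<le> real q ^ m - 1"
  proof -
    have "real m * (real q ^ m - 1) \<le> (real m + 1) * sum f J"
      using that unfolding split by (simp add: algebra_simps)
    thus ?thesis by (simp add: f_def)
  qed
  have f_nonneg: "real q ^ d - 1 \<ge> 0" for d using q by (simp add: one_le_power)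
  have real_diff: "real (q ^ d - 1) = real q ^ d - 1" for d using q by (simp add: of_nat_diff Suc_leI)
  consider "m = 1" | "primepow m" | "m = 6" "q = 2" | "\<not> primepow m" "m > 1" "m \<noteq> 6 \<or> q \<noteq> 2"
    using m by linarith
  thus ?thesis
  proof cases
    case 1
    hence "J - {1} = {}" using J(1) by auto
    hence "sum f (J - {1}) = 0" by (simp only: sum.empty)
    thus ?thesis using 1 q by (intro goal) simp
  next
    case 2
    then obtain p k where p: "prime p" "k > 0" "m = p ^ k" unfolding primepow_def by auto
    define d where "d = p ^ (k - 1)"
    have md: "m = p * d" using p by (cases k) (simp_all add: d_def)
    have d0: "d > 0" using md m by (intro Nat.gr0I) simp
    have zero: "f j = 0" if j: "j \<in> J - {1} - {p}" for j
    proof -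
      have "j dvd p ^ k" using J(1) j p by auto
      then obtain i where i: "j = p ^ i" using divides_primepow_nat[OF p(1)] by blast
      hence "i \<noteq> 0" "i \<noteq> 1" using j by auto
      hence "p * p dvd j" using le_imp_power_dvd[of 2 i p] by (simp add: i power2_eq_square)
      thus ?thesis using moebius_mu_eq_0[OF p(1)] by (simp add: f_def)
    qed
    have "sum f (J - {1}) = sum f ((J - {1}) \<inter> {p})"
      using zero fin by (intro sum.mono_neutral_right) auto
    moreover have "f p = - (real q ^ d - 1)"
      using moebius_mu_prime[OF p(1)] prime_gt_0_nat[OF p(1)] by (simp add: f_def md)
    ultimately have "- sum f (J - {1}) \<le> real q ^ d - 1"
      using f_nonneg[of d] by (cases "p \<in> J - {1}") auto
    hence "(real m + 1) * - sum f (J - {1}) \<le> (real m + 1) * (real q ^ d - 1)"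
      by (intro mult_left_mono) auto
    also have "\<dots> = real ((m + 1) * (q ^ d - 1))"
      by (simp only: of_nat_mult of_nat_add of_nat_1 real_diff)
    also have "\<dots> \<le> real (q ^ m - 1)"
      unfolding md of_nat_le_iff
      using primepow_power_quotient_bound[OF q d0 prime_ge_2_nat[OF p(1)]] .
    also have "\<dots> = real q ^ m - 1" by (rule real_diff)
    finally show ?thesis by (intro goal) simp
  next
    case 3
    have 236: "J - {1} \<subseteq> {2, 3, 6}"
    proof
      fix j assume j: "j \<in> J - {1}"
      hence "j dvd 6" using J(1) 3 by auto
      moreover from this have "j \<le> 6" by (rule dvd_imp_le) simp
      moreover have "j \<noteq> 0" "j \<noteq> 4" "j \<noteq> 5" using \<open>j dvd 6\<close> by (auto intro: Nat.gr0I)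
      ultimately show "j \<in> {2, 3, 6}" using j by auto
    qed
    have mu: "moebius_mu 2 = -1" "moebius_mu 3 = -1" "moebius_mu 6 = 1"
      using moebius_mu_prime[of 2] moebius_mu_prime[of 3] moebius_mu_prime_mult[of 2 3] by simp_all
    \<comment> \<open>The three values are -7, -3 and 1, and 7 (7 + 3 - 1) = 63 = 2^6 - 1 is the
      case of equality.\<close>
    have "sum f (J - {1}) = (\<Sum>j\<in>{2, 3, 6}. if j \<in> J then f j else 0)"
    proof -
      have "J - {1} = {j \<in> {2, 3, 6}. j \<in> J}" using 236 by auto
      thus ?thesis by (simp only: sum.inter_filter finite.intros)
    qed
    thus ?thesis using six 3 by (intro goal) (auto simp: f_def mu split: if_splits)
  next
    case 4
    define h where "h = m div 2"
    \<comment> \<open>Either \<open>m = 6\<close>, so that \<open>h = 3\<close> and \<open>q\<close>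
      is at least 3, or \<open>m\<close> is at least 10, so that \<open>h\<close> is at least
      5.\<close>
    have h: "h \<ge> 5 \<or> (h \<ge> 3 \<and> q \<ge> 3)" "2 * h \<le> m" "m \<le> 2 * h + 1"
      using not_primepow_ge_6[OF 4(1,2)] 4(3) q by (auto simp: h_def)
    have "- sum f (J - {1}) = (\<Sum>j\<in>J - {1}. - f j)" by (simp add: sum_negf)
    also have "\<dots> \<le> (\<Sum>j\<in>J - {1}. real q ^ (m div j) - 1)"
    proof (rule sum_mono)
      fix j
      have "- real_of_int (moebius_mu j) \<le> 1" using abs_moebius_mu_le_1[of j] by linarith
      hence "- real_of_int (moebius_mu j) * (real q ^ (m div j) - 1) \<le> 1 * (real q ^ (m div j) - 1)"
        by (rule mult_right_mono) (rule f_nonneg)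
      thus "- f j \<le> real q ^ (m div j) - 1" by (simp add: f_def)
    qed
    \<comment> \<open>Distinct \<open>j\<close> have distinct codivisors d = m / j, all at most m /
      2 for j \<ge> 2, so the sum may be enlarged to all d \<le> h.\<close>
    also have "\<dots> = (\<Sum>d\<in>(\<lambda>j. m div j) ` (J - {1}). real q ^ d - 1)"
    proof -
      have "inj_on (\<lambda>j. m div j) (J - {1})"
      proof (rule inj_onI)
        fix i j assume ij: "i \<in> J - {1}" "j \<in> J - {1}" "m div i = m div j"
        have *: "m div i * i = m" "m div j * j = m" using J(1) ij(1,2) by auto
        hence "m div i * i = m div i * j" using ij(3) by simp
        moreover have "m div i \<noteq> 0" using *(1) m by (metis mult_0 less_irrefl)
        ultimately show "i = j" by simp
      qed
      thus ?thesis by (simp add: sum.reindex)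
    qed
    also have "\<dots> \<le> (\<Sum>d=1..h. real q ^ d - 1)"
    proof (rule sum_mono2)
      show "(\<lambda>j. m div j) ` (J - {1}) \<subseteq> {1..h}"
      proof (rule image_subsetI)
        fix j assume j: "j \<in> J - {1}"
        hence "j dvd m" using J(1) by auto
        then obtain l where l: "m = j * l" ..
        hence "j \<noteq> 0" "l \<noteq> 0" using m by auto
        hence "m div j > 0" by (simp add: l)
        moreover have "j \<ge> 2" using \<open>j \<noteq> 0\<close> j by auto
        moreover from this have "m div j \<le> m div 2" by (intro div_le_mono2) auto
        ultimately show "m div j \<in> {1..h}" by (simp add: h_def)
      qed
    qed (use f_nonneg in auto)
    also have "\<dots> \<le> 2 * (real q ^ h - 1)" by (rule sum_powers_le[OF q])
    finally have "(real m + 1) * - sum f (J - {1}) \<le> (real m + 1) * (2 * (real q ^ h - 1))"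
      by (intro mult_left_mono) auto
    also have "\<dots> \<le> (2 * real h + 2) * (2 * (real q ^ h - 1))"
      using h(3) f_nonneg[of h] by (intro mult_right_mono) auto
    also have "\<dots> = (4 * real h + 4) * (real q ^ h - 1)" by (simp add: algebra_simps)
    also have "\<dots> \<le> (real q ^ h + 1) * (real q ^ h - 1)"
    proof (rule mult_right_mono[OF _ f_nonneg])
      have "real (4 * h + 3) \<le> real (q ^ h)"
        using four_mult_add_three_le_power[OF q h(1)] of_nat_le_iff by blast
      thus "4 * real h + 4 \<le> real q ^ h + 1" by simp
    qed
    also have "\<dots> = real q ^ (2 * h) - 1" 
      unfolding mult_2 power_add by (simp add: algebra_simps)
    also have "\<dots> \<le> real q ^ m - 1" using h(2) q by (simp add: power_increasing)
    finally show ?thesis by (intro goal) simp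
  qed
qed

section \<open>Roots of unity in algebraically closed fields\<close>

lemma power_cong_exponent:
  assumes "(x :: 'a :: monoid_mult) ^ n = 1" "[a = b] (mod n)"
  shows "x ^ a = x ^ b"
proof -
  have "x ^ c = x ^ (c mod n)" for c
    using assms(1) by (metis mult_div_mod_eq power_add power_mult power_one mult_1)
  thus ?thesis using assms(2) by (metis cong_def)
qed

lemma power_coprime_eq_1:
  assumes "(z :: 'a :: monoid_mult) ^ a = 1" "z ^ b = 1" "coprime a b"
  shows "z = 1"
proof (cases "a = 0")
  case True
  thus ?thesis using assms by simp
next
  case False
  then obtain u v where "a * u = b * v + 1" using bezout_nat[of a b] assms(3) by auto
  hence "z ^ (b * v + 1) = z ^ (a * u)" by simp
  thus ?thesis using assms by (simp only: power_add power_mult) simp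
qed

lemma power_Suc_eq_self_iff:
  assumes "(z :: 'a :: field) \<noteq> 0" "n > 0"
  shows "z ^ n = z \<longleftrightarrow> z ^ (n - 1) = 1"
  using assms by (cases n) auto

text \<open>Split X^n - 1 into linear factors. A double root would be a root of the derivative n
  X^(n-1), hence 0 because \<open>n\<close> is invertible, but 0 is no root of unity.\<close>

lemma card_roots_of_unity:
  assumes "of_nat n \<noteq> (0 :: 'a :: alg_closed_field)"
  shows "card {x :: 'a. x ^ n = 1} = n"
proof -
  have n: "n > 0" using assms by (intro Nat.gr0I) auto
  define P :: "'a poly" where "P = monom 1 n - 1"
  have dP: "degree P = n"
    using degree_add_eq_left[of "- 1" "monom (1 :: 'a) n"] n by (simp add: P_def degree_monom_eq)
  hence nz: "P \<noteq> 0" using n by auto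
  obtain A c where A: "size A = n" "P = smult c (\<Prod>x\<in>#A. [:- x, 1:])"
    using alg_closed_imp_factorization[OF nz] dP by metis
  have roots: "set_mset A = {x. x ^ n = 1}"
  proof -
    have "poly P x = 0 \<longleftrightarrow> x \<in># A" for x
      using nz unfolding A(2) by (auto simp: poly_prod_mset prod_mset_zero_iff)
    thus ?thesis by (auto simp: P_def poly_monom)
  qed
  have "count A x = 1" if x: "x \<in># A" for x
  proof (rule ccontr)
    assume "count A x \<noteq> 1"
    moreover have "count A x > 0" using x by simp
    ultimately have "Suc (Suc 0) \<le> count A x" by linarith
    hence "{#x, x#} \<subseteq># A" by (intro mset_subset_eqI) auto
    then obtain C where "A = {#x, x#} + C" by (metis subset_mset.le_iff_add)
    hence "P = [:- x, 1:] * ([:- x, 1:] * smult c (\<Prod>x\<in>#C. [:- x, 1:]))"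
      using A(2) by simp
    then obtain r where P: "P = [:- x, 1:] * ([:- x, 1:] * r)" by blast
    have "poly (pderiv P) x = 0" unfolding P pderiv_mult by simp
    hence "of_nat n * x ^ (n - 1) = 0" by (simp add: P_def pderiv_diff pderiv_monom poly_monom)
    hence "x = 0" using assms by simp
    thus False using x roots n by (simp add: power_0_left)
  qed
  hence "mset_set (set_mset A) = A" by (intro multiset_eqI) (auto simp: count_eq_zero_iff count_mset_set')
  hence "card (set_mset A) = n" using A(1) by (metis size_mset_set)
  thus ?thesis by (simp add: roots)
qed

text \<open>Primes are removed one at a time. With n = p n', the elements to discard are those
  avoiding \<open>D\<close> for n', so the hypothesis at n and n' gives the factor 1 - 1/p.\<close>

lemma card_roots_of_unity_avoiding:
  assumes "finite D" "\<And>p. p \<in> D \<Longrightarrow> prime p" "(\<Prod>D) dvd n"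
    and "of_nat n \<noteq> (0 :: 'a :: alg_closed_field)"
  shows "real (card {x :: 'a. x ^ n = 1 \<and> (\<forall>p\<in>D. x ^ (n div p) \<noteq> 1)}) = real n * (\<Prod>p\<in>D. 1 - 1 / real p)"
  using assms
proof (induction D arbitrary: n rule: finite_induct)
  case (insert p D)
  have p: "prime p" "p > 0" using insert.prems(1)[of p] prime_gt_0_nat by auto
  have "p dvd n" using insert.prems(2) insert.hyps by (simp add: dvd_mult_left)
  then obtain n' where n: "n = p * n'" ..
  have D: "(\<Prod>D) dvd n'" using insert.prems(2) insert.hyps p(2) by (simp add: n)
  have D': "(\<Prod>D) dvd n" using D by (simp add: n)
  have nz: "of_nat n' \<noteq> (0 :: 'a)" using insert.prems(3) by (simp add: n)
  define W where "W n = {x :: 'a. x ^ n = 1 \<and> (\<forall>r\<in>D. x ^ (n div r) \<noteq> 1)}" for n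
  have n0: "n > 0" using insert.prems(3) by (intro Nat.gr0I) auto
  have fin: "finite (W n)"
  proof -
    have "finite {x :: 'a. x ^ n = 1}"
      using card_roots_of_unity[OF insert.prems(3)] n0 by (metis card.infinite less_numeral_extra(3))
    thus ?thesis by (rule finite_subset[rotated]) (auto simp: W_def)
  qed
  \<comment> \<open>The left side is the \<open>p\<close>-th power of x^(n'/r), whose order divides
    \<open>r\<close>; as \<open>p\<close> and \<open>r\<close> are coprime, this power is 1 only if
    the element is.\<close>
  have "x ^ (n div r) = 1 \<longleftrightarrow> x ^ (n' div r) = 1" if r: "r \<in> D" and x: "x ^ n' = 1" for x :: 'a and r
  proof -
    have rn: "r dvd n'" using D r insert.hyps(1) by (meson dvd_prodI dvd_trans)
    hence eq: "n div r = (n' div r) * p" by (simp add: n div_mult_swap mult.commute)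
    have "coprime p r" using p(1) insert.prems(1) insert.hyps(2) r by (metis insertI2 primes_coprime)
    moreover have "(x ^ (n' div r)) ^ r = 1" using rn x by (simp flip: power_mult)
    ultimately show ?thesis unfolding eq power_mult using power_coprime_eq_1 power_one by metis
  qed
  hence "{x \<in> W n. x ^ n' = 1} = W n'"
    by (auto simp: W_def n power_mult mult.commute[of p])
  moreover have "{x. x ^ n = 1 \<and> (\<forall>r\<in>insert p D. x ^ (n div r) \<noteq> 1)} = W n - {x \<in> W n. x ^ n' = 1}"
    using p(2) by (auto simp: W_def n)
  ultimately have eq: "{x. x ^ n = 1 \<and> (\<forall>r\<in>insert p D. x ^ (n div r) \<noteq> 1)} = W n - W n'"
    and sub: "W n' \<subseteq> W n" by auto
  have "real (card (W n - W n')) = real (card (W n)) - real (card (W n'))"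
    using card_Diff_subset[OF finite_subset[OF sub fin] sub] card_mono[OF fin sub] by simp
  also have "\<dots> = real n * (\<Prod>p\<in>D. 1 - 1 / real p) - real n' * (\<Prod>p\<in>D. 1 - 1 / real p)"
    using insert.IH[OF _ D' insert.prems(3)] insert.IH[OF _ D nz] insert.prems(1) by (simp add: W_def)
  also have "\<dots> = real n * (\<Prod>p\<in>insert p D. 1 - 1 / real p)"
    using insert.hyps p(2) by (simp add: n field_simps)
  finally show ?case by (simp only: eq)
qed (simp add: card_roots_of_unity)

section \<open>Degrees of elements of the algebraic closure of a finite field\<close>

lemma hom_sum:
  assumes "h (0 :: 'a :: comm_monoid_add) = (0 :: 'b :: comm_monoid_add)"
    and "\<And>x y. h (x + y) = h x + h y"
  shows "h (sum f A) = (\<Sum>x\<in>A. h (f x))"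
  by (induction A rule: infinite_finite_induct) (simp_all add: assms)

text \<open>The map \<open>h\<close> is kept general to serve both the embedding
  \<open>to_ac\<close> and the Frobenius map.\<close>

lemma map_poly_mult_hom:
  fixes h :: "'a :: comm_semiring_1 \<Rightarrow> 'b :: comm_semiring_1"
  assumes "h 0 = 0" "\<And>x y. h (x + y) = h x + h y" "\<And>x y. h (x * y) = h x * h y"
  shows "map_poly h (p * q) = map_poly h p * map_poly h q"
  by (intro poly_eqI) (simp add: coeff_map_poly coeff_mult hom_sum[of h] assms)

lemma map_poly_prod_hom:
  fixes h :: "'a :: comm_semiring_1 \<Rightarrow> 'b :: comm_semiring_1"
  assumes "h 0 = 0" "\<And>x y. h (x + y) = h x + h y" "\<And>x y. h (x * y) = h x * h y" "h 1 = 1"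
  shows "map_poly h (\<Prod>i\<in>A. f i) = (\<Prod>i\<in>A. map_poly h (f i))"
  by (induction A rule: infinite_finite_induct) (simp_all add: assms map_poly_mult_hom)

text \<open>Translation by 1 permutes the field, so the sum of all elements does not change when 1
  is added to each.\<close>

lemma of_nat_CARD_eq_0: "of_nat CARD('a) = (0 :: 'a :: finite_field)"
proof -
  have "(\<Sum>y\<in>UNIV. y + 1) = (\<Sum>y\<in>UNIV. y :: 'a)"
    by (rule sum.reindex_bij_witness[of _ "\<lambda>y. y - 1" "\<lambda>y. y + 1"]) auto
  thus ?thesis by (simp add: sum.distrib)
qed

text \<open>This makes raising to the power \<open>q\<close> an iterate of the characteristic
  Frobenius map, hence additive.\<close>

lemma CARD_eq_CHAR_power:
  assumes "primepow CARD('a :: finite_field)"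
  obtains n where "n > 0" "CARD('a) = CHAR('a) ^ n"
proof -
  obtain p n where pn: "prime p" "n > 0" "CARD('a) = p ^ n"
    using assms unfolding primepow_def by auto
  have "prime CHAR('a)" using prime_CHAR_semidom[where 'a='a] CHAR_pos by blast
  moreover have "CHAR('a) dvd p ^ n"
    using of_nat_CARD_eq_0[where 'a='a] pn(3) by (metis of_nat_eq_0_iff_char_dvd)
  ultimately have "CHAR('a) = p" using pn(1) prime_dvd_power primes_dvd_imp_eq by blast
  thus ?thesis using that pn by simp
qed

section \<open>Evaluating polynomials in the algebraic closure\<close>

definition ac_eval :: "'a :: field poly \<Rightarrow> 'a alg_closure \<Rightarrow> 'a alg_closure" where
  "ac_eval f x = poly (map_poly to_ac f) x"

lemma ac_eval_0 [simp]: "ac_eval 0 x = 0"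
  by (simp add: ac_eval_def)

lemma ac_eval_pCons [simp]: "ac_eval (pCons a f) x = to_ac a + x * ac_eval f x"
  by (simp add: ac_eval_def map_poly_pCons)

lemma ac_eval_add [simp]: "ac_eval (f + g) x = ac_eval f x + ac_eval g x"
proof -
  have "map_poly to_ac (f + g) = map_poly to_ac f + map_poly to_ac g"
    by (intro poly_eqI) (simp add: coeff_map_poly)
  thus ?thesis by (simp add: ac_eval_def)
qed

lemma ac_eval_diff [simp]: "ac_eval (f - g) x = ac_eval f x - ac_eval g x"
  using ac_eval_add[of "f - g" g x] by (simp add: eq_diff_eq del: ac_eval_add)

lemma ac_eval_mult [simp]: "ac_eval (f * g) x = ac_eval f x * ac_eval g x"
  by (simp add: ac_eval_def map_poly_mult_hom)

lemma ac_eval_pcompose_monom [simp]: "ac_eval (f \<circ>\<^sub>p monom 1 t) x = ac_eval f (x ^ t)"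
proof (induction f)
  case (pCons a f)
  have "ac_eval (monom 1 t) x = x ^ t" by (simp add: ac_eval_def map_poly_monom poly_monom)
  thus ?case using pCons by (simp add: pcompose_pCons)
qed simp

lemma degree_map_poly_to_ac [simp]: "degree (map_poly to_ac f) = degree f"
  by (intro degree_map_poly) simp

lemma map_poly_to_ac_eq_0_iff [simp]: "map_poly to_ac f = 0 \<longleftrightarrow> f = 0"
  by (subst map_poly_eq_0_iff) auto

lemma finite_ac_roots: "f \<noteq> 0 \<Longrightarrow> finite {x. ac_eval f x = 0}"
  unfolding ac_eval_def by (rule poly_roots_finite) simp

lemma card_ac_roots_le: "f \<noteq> 0 \<Longrightarrow> card {x. ac_eval f x = 0} \<le> degree f"
  unfolding ac_eval_def using card_poly_roots_bound[of "map_poly to_ac f"] by simp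

lemma ac_root_exists: "degree f > 0 \<Longrightarrow> \<exists>x. ac_eval f x = 0"
  unfolding ac_eval_def by (rule alg_closed_imp_poly_has_root) simp

section \<open>The Frobenius map and the degree of an element\<close>

locale finite_field_primepow =
  fixes F :: "'a :: finite_field itself" and q :: nat
  assumes CARD_eq: "CARD('a) = q" and primepow: "primepow q"
begin

definition fdeg :: "'a alg_closure \<Rightarrow> nat" where
  "fdeg x = (LEAST n. n > 0 \<and> x ^ (q ^ n) = x)"

lemma q_ge_2: "q \<ge> 2"
  using primepow_gt_Suc_0[OF primepow] by simp

lemma q_gt_0: "q > 0"
  using q_ge_2 by simp

lemma q_power_CHAR: obtains n where "q ^ k = CHAR('a alg_closure) ^ n"
proof -
  obtain n where "q = CHAR('a) ^ n" 
    using CARD_eq_CHAR_power[where 'a='a] primepow CARD_eq by metis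
  hence "q ^ k = CHAR('a alg_closure) ^ (n * k)" by (simp add: power_mult)
  thus ?thesis using that by blast
qed

lemma prime_CHAR_ac: "prime CHAR('a alg_closure)"
  using prime_CHAR_semidom[where 'a='a] CHAR_pos[where 'a='a] by simp

lemma add_power_q: "((x :: 'a alg_closure) + y) ^ (q ^ k) = x ^ (q ^ k) + y ^ (q ^ k)"
  by (metis q_power_CHAR freshmans_dream' prime_CHAR_ac)

lemma power_q_eq_iff: "(x :: 'a alg_closure) ^ (q ^ k) = y ^ (q ^ k) \<longleftrightarrow> x = y"
proof
  assume "x ^ (q ^ k) = y ^ (q ^ k)"
  hence "(x - y) ^ (q ^ k) = 0" using add_power_q[of "x - y" y k] by simp
  thus "x = y" by simp
qed simp

lemma uminus_power_q: "(- (x :: 'a alg_closure)) ^ (q ^ k) = - (x ^ (q ^ k))"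
  using add_power_q[of x "- x" k] q_ge_2 by (simp add: eq_neg_iff_add_eq_0 add.commute power_0_left)

lemma to_ac_power_q: "to_ac (x :: 'a) ^ q = to_ac x"
  by (metis CARD_eq finite_field_power_card_eq_same to_ac_power)

text \<open>X^q - X has at most \<open>q\<close> roots, and the \<open>q\<close> elements of the
  base field are already roots.\<close>

lemma power_q_fixed_imp_range:
  assumes "(x :: 'a alg_closure) ^ q = x"
  shows "x \<in> range to_ac"
proof -
  define P :: "'a alg_closure poly" where "P = monom 1 q - monom 1 1"
  have dP: "degree P = q"
    
    using degree_add_eq_left[of "- monom 1 1" "monom (1 :: 'a alg_closure) q"] q_ge_2
    by (simp add: P_def degree_monom_eq)
  hence "P \<noteq> 0" using q_ge_2 by auto
  have "range to_ac \<subseteq> {x. poly P x = 0}"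
    by (auto simp: P_def poly_monom to_ac_power_q)
  moreover have "card {x. poly P x = 0} \<le> card (range (to_ac :: 'a \<Rightarrow> _))"
    using card_poly_roots_bound[OF \<open>P \<noteq> 0\<close>] dP card_image[OF inj_to_ac[where 'a='a]] CARD_eq by simp
  ultimately have "range to_ac = {x. poly P x = 0}"
    using poly_roots_finite[OF \<open>P \<noteq> 0\<close>] card_seteq by blast
  thus ?thesis using assms by (auto simp: P_def poly_monom)
qed

lemma ac_eval_power_q: "ac_eval (f :: 'a poly) (x ^ (q ^ k)) = ac_eval f x ^ (q ^ k)"
proof (induction f)
  case 0
  thus ?case using q_ge_2 by (simp add: power_0_left)
next
  case (pCons a f)
  have "to_ac a ^ (q ^ k) = to_ac a"
    by (induction k) (simp_all add: power_mult to_ac_power_q)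
  thus ?case using pCons by (simp add: add_power_q power_mult_distrib)
qed

text \<open>All Frobenius images of \<open>x\<close> are roots of one nonzero polynomial, so two of
  them coincide, and injectivity cancels the smaller exponent. Thus the \<open>LEAST\<close> in
  \<open>fdeg\<close> is attained.\<close>

lemma fdeg_exists: "\<exists>n>0. (x :: 'a alg_closure) ^ (q ^ n) = x"
proof -
  obtain f :: "'a poly" where f: "f \<noteq> 0" "ac_eval f x = 0"
    using alg_closure_algebraic[of x] unfolding ac_eval_def by blast
  have "range (\<lambda>i. x ^ (q ^ i)) \<subseteq> {y. ac_eval f y = 0}"
    using f q_ge_2 by (auto simp: ac_eval_power_q power_0_left)
  hence "finite (range (\<lambda>i. x ^ (q ^ i)))" using finite_ac_roots[OF f(1)] finite_subset by blast
  hence "\<not> inj (\<lambda>i. x ^ (q ^ i))" using finite_imageD infinite_UNIV_nat by blast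
  then obtain i j where ij: "i < j" "x ^ (q ^ i) = x ^ (q ^ j)"
    unfolding inj_def by (metis linorder_neqE_nat)
  have "x ^ (q ^ j) = (x ^ (q ^ (j - i))) ^ (q ^ i)"
    using ij(1) by (simp flip: power_mult power_add)
  hence "x ^ (q ^ (j - i)) = x" using ij(2) power_q_eq_iff by metis
  thus ?thesis using ij(1) by (intro exI[of _ "j - i"]) auto
qed

lemma fdeg_pos: "fdeg (x :: 'a alg_closure) > 0" and power_fdeg: "x ^ (q ^ fdeg x) = x"
  using LeastI_ex[OF fdeg_exists[of x]] unfolding fdeg_def by auto

lemma fdeg_le: "n > 0 \<Longrightarrow> (x :: 'a alg_closure) ^ (q ^ n) = x \<Longrightarrow> fdeg x \<le> n"
  unfolding fdeg_def by (rule Least_le) auto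

lemma power_q_mult_fdeg: "(x :: 'a alg_closure) ^ (q ^ (fdeg x * k)) = x"
  by (induction k) (simp_all add: power_add power_mult power_fdeg)

lemma power_q_eq_self_iff: "(x :: 'a alg_closure) ^ (q ^ n) = x \<longleftrightarrow> fdeg x dvd n"
proof
  assume *: "x ^ (q ^ n) = x"
  define r where "r = n mod fdeg x"
  have "n = fdeg x * (n div fdeg x) + r" by (simp add: r_def)
  hence "x ^ (q ^ n) = (x ^ (q ^ (fdeg x * (n div fdeg x)))) ^ (q ^ r)"
    by (metis power_add power_mult)
  hence "x ^ (q ^ r) = x" using * by (simp add: power_q_mult_fdeg)
  moreover have "r < fdeg x" using fdeg_pos by (simp add: r_def)
  ultimately have "r = 0" using fdeg_le[of r x] by force
  thus "fdeg x dvd n" by (simp add: r_def dvd_eq_mod_eq_0)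
qed (auto simp: power_q_mult_fdeg)

section \<open>Conjugates and minimal polynomials\<close>

definition conjugates :: "'a alg_closure \<Rightarrow> 'a alg_closure set" where
  "conjugates x = (\<lambda>i. x ^ (q ^ i)) ` {..<fdeg x}"

lemma inj_on_conjugates: "inj_on (\<lambda>i. (x :: 'a alg_closure) ^ (q ^ i)) {..<fdeg x}"
proof (rule linorder_inj_onI)
  fix i j assume ij: "i < j" "i \<in> {..<fdeg x}" "j \<in> {..<fdeg x}"
  show "x ^ (q ^ i) \<noteq> x ^ (q ^ j)"
  proof
    assume "x ^ (q ^ i) = x ^ (q ^ j)"
    also have "x ^ (q ^ j) = (x ^ (q ^ (j - i))) ^ (q ^ i)"
      using ij(1) by (simp flip: power_mult power_add)
    finally have "x ^ (q ^ (j - i)) = x" using power_q_eq_iff by metis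
    hence "fdeg x \<le> j - i" using ij by (intro fdeg_le) auto
    thus False using ij by auto
  qed
qed auto

lemma card_conjugates: "card (conjugates x) = fdeg x"
  unfolding conjugates_def by (simp add: card_image inj_on_conjugates)

lemma conjugates_subset_roots: "ac_eval f x = 0 \<Longrightarrow> conjugates x \<subseteq> {y. ac_eval f y = 0}"
  using q_ge_2 by (auto simp: conjugates_def ac_eval_power_q power_0_left)

text \<open>The conjugates of \<open>x\<close> are \<open>fdeg x\<close> distinct roots of
  \<open>f\<close>.\<close>

lemma fdeg_le_degree:
  assumes "f \<noteq> 0" "ac_eval (f :: 'a poly) x = 0"
  shows "fdeg x \<le> degree f"
  using card_mono[OF finite_ac_roots[OF assms(1)] conjugates_subset_roots[OF assms(2)]]
    card_ac_roots_le[OF assms(1)] by (simp add: card_conjugates)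

text \<open>The polynomial with the conjugates as simple roots is fixed by the Frobenius map.\<close>

lemma minimal_poly_exists:
  obtains g :: "'a poly" where "lead_coeff g = 1" "degree g = fdeg x" "ac_eval g x = 0"
proof -
  define P where "P = (\<Prod>y\<in>conjugates x. [:- y, 1:])"
  have fin: "finite (conjugates x)" by (simp add: conjugates_def)
  have x_in: "x \<in> conjugates x"
    unfolding conjugates_def using fdeg_pos[of x] by (intro image_eqI[of _ _ 0]) auto
  have inj: "inj_on (\<lambda>y. y ^ q) (conjugates x)"
    using power_q_eq_iff[of _ 1] by (auto simp: inj_on_def)
  have "(\<lambda>y. y ^ q) ` conjugates x \<subseteq> conjugates x"
  proof (clarsimp simp: conjugates_def)
    fix i assume i: "i < fdeg x"
    \<comment> \<open>Frobenius raises the index by one, and the last conjugate returns to index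
      0.\<close>
    have eq: "(x ^ q ^ i) ^ q = x ^ (q ^ Suc i)" by (simp add: mult.commute flip: power_mult)
    show "(x ^ q ^ i) ^ q \<in> (\<lambda>i. x ^ q ^ i) ` {..<fdeg x}"
    proof (cases "Suc i = fdeg x")
      case True
      hence "(x ^ q ^ i) ^ q = x ^ q ^ 0" unfolding eq by (simp add: power_fdeg del: power_Suc)
      thus ?thesis using fdeg_pos[of x] by blast
    next
      case False
      thus ?thesis unfolding eq using i by (intro imageI) auto
    qed
  qed
  hence surj: "(\<lambda>y. y ^ q) ` conjugates x = conjugates x"
    using endo_inj_surj[OF fin _ inj] by blast
  have "map_poly (\<lambda>y. y ^ q) P = (\<Prod>y\<in>conjugates x. map_poly (\<lambda>y. y ^ q) [:- y, 1:])"
    unfolding P_def using add_power_q[where k=1] q_ge_2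
    by (intro map_poly_prod_hom) (auto simp: power_0_left power_mult_distrib)
  also have "\<dots> = (\<Prod>y\<in>conjugates x. [:- (y ^ q), 1:])"
    using uminus_power_q[where k=1] q_ge_2 by (intro prod.cong) (simp_all add: map_poly_pCons power_0_left)
  also have "\<dots> = (\<Prod>y\<in>(\<lambda>y. y ^ q) ` conjugates x. [:- y, 1:])"
    by (simp add: prod.reindex inj)
  finally have fixed: "map_poly (\<lambda>y. y ^ q) P = P" by (simp add: surj P_def)
  \<comment> \<open>Coefficients fixed by Frobenius lie in the base field, so \<open>P\<close>
    descends to a polynomial \<open>g\<close> there.\<close>
  have "coeff P i \<in> range to_ac" for i
  proof (rule power_q_fixed_imp_range)
    have "coeff (map_poly (\<lambda>y. y ^ q) P) i = coeff P i ^ q"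
      using q_ge_2 by (simp add: coeff_map_poly power_0_left)
    thus "coeff P i ^ q = coeff P i" by (simp add: fixed)
  qed
  hence P: "map_poly to_ac (map_poly of_ac P) = P"
    by (intro poly_eqI) (simp add: coeff_map_poly to_ac_of_ac)
  define g where "g = map_poly of_ac P"
  have "degree P = fdeg x"
    unfolding P_def by (subst degree_prod_eq_sum_degree) (auto simp: card_conjugates)
  moreover have "lead_coeff P = 1" by (simp add: P_def lead_coeff_prod)
  moreover have "poly P x = 0" using fin x_in by (auto simp: P_def poly_prod)
  moreover have "degree g = degree P" using P degree_map_poly_to_ac[of g] by (simp add: g_def)
  moreover have "to_ac (lead_coeff g) = lead_coeff P"
    using P \<open>degree g = degree P\<close> unfolding g_def by (metis coeff_map_poly to_ac_0)
  ultimately show ?thesis using P by (intro that[of g]) (simp_all add: ac_eval_def g_def)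
qed

text \<open>An irreducible \<open>f\<close> is a constant multiple of the minimal polynomial, since
  the remainder vanishes at \<open>x\<close> and has too small a degree. Conversely, a factor
  vanishing at \<open>x\<close> already has full degree, so the other one is constant.\<close>

lemma irreducible_iff_degree_eq_fdeg:
  assumes "f \<noteq> 0" "ac_eval (f :: 'a poly) x = 0"
  shows "irreducible f \<longleftrightarrow> degree f = fdeg x"
proof
  assume irr: "irreducible f"
  obtain g where g: "lead_coeff g = 1" "degree g = fdeg x" "ac_eval g x = 0"
    using minimal_poly_exists .
  have "ac_eval (g * (f div g)) x + ac_eval (f mod g) x = 0"
    using assms(2) by (metis ac_eval_add mult_div_mod_eq)
  hence "ac_eval (f mod g) x = 0" using g by simp
  moreover have "f mod g = 0 \<or> degree (f mod g) < degree g"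
    using g fdeg_pos[of x] by (intro degree_mod_less) auto
  ultimately have "f mod g = 0" using fdeg_le_degree g(2) by (metis leD)
  then obtain h where h: "f = g * h" by (auto simp: mod_eq_0_iff_dvd)
  have nz: "g \<noteq> 0" "h \<noteq> 0" using assms(1) h by auto
  hence "\<not> is_unit g" using g fdeg_pos[of x] by (simp add: is_unit_iff_degree)
  hence "is_unit h" using irreducibleD[OF irr h] by simp
  hence "degree h = 0" using nz by (simp add: is_unit_iff_degree)
  thus "degree f = fdeg x" using assms(1) g(2) h by (simp add: degree_mult_eq)
next
  assume deg: "degree f = fdeg x"
  show "irreducible f"
  proof (rule irreducibleI)
    show "\<not> is_unit f" using assms(1) deg fdeg_pos[of x] by (simp add: is_unit_iff_degree)
    fix a b assume ab: "f = a * b"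
    hence nz: "a \<noteq> 0" "b \<noteq> 0" using assms(1) by auto
    hence d: "degree f = degree a + degree b" using ab by (simp add: degree_mult_eq)
    have "ac_eval a x = 0 \<or> ac_eval b x = 0" using assms(2) ab by simp
    hence "degree b = 0 \<or> degree a = 0"
      using fdeg_le_degree[of a x] fdeg_le_degree[of b x] nz d deg by linarith
    thus "is_unit a \<or> is_unit b" using nz by (auto simp: is_unit_iff_degree)
  qed (use assms in auto)
qed

section \<open>From hyper-irreducible polynomials to their roots\<close>

lemma fdeg_root_le:
  assumes "y ^ s = (x :: 'a alg_closure)" "s > 0"
  shows "fdeg y \<le> s * fdeg x"
proof -
  obtain g :: "'a poly" where g: "lead_coeff g = 1" "degree g = fdeg x" "ac_eval g x = 0"
    using minimal_poly_exists .
  have d: "degree (g \<circ>\<^sub>p monom 1 s) = s * fdeg x"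
    using g by (simp add: degree_pcompose degree_monom_eq)
  hence "g \<circ>\<^sub>p monom 1 s \<noteq> 0" using assms(2) fdeg_pos[of x] by auto
  thus ?thesis using fdeg_le_degree[of "g \<circ>\<^sub>p monom 1 s" y] g assms(1) d by simp
qed

text \<open>For positive \<open>m\<close> and \<open>t\<close> these are the roots of the
  polynomials counted by \<open>N_star\<close>; 0 is left out because the polynomial X is.\<close>

definition hyper_elements :: "nat \<Rightarrow> nat \<Rightarrow> 'a alg_closure set" where
  "hyper_elements m t = {x. x \<noteq> 0 \<and> fdeg x = m \<and> (\<forall>y. y ^ t = x \<longrightarrow> fdeg y = m * t)}"

text \<open>\<open>y\<close> is a root of the composed polynomial, so a single \<open>t\<close>-th
  root of a single root of \<open>f\<close> decides irreducibility.\<close>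

lemma hyper_irreducible_iff:
  assumes "f \<noteq> 0" "ac_eval f (y ^ t) = 0" "t > 0"
  shows "hyper_irreducible t (f :: 'a poly) \<longleftrightarrow> fdeg y = degree f * t"
proof -
  have d: "degree (f \<circ>\<^sub>p monom 1 t) = degree f * t"
    by (simp add: degree_pcompose degree_monom_eq)
  have "f \<circ>\<^sub>p monom 1 t \<noteq> 0"
    using assms by (subst pcompose_eq_0_iff) (auto simp: degree_monom_eq)
  thus ?thesis
    unfolding hyper_irreducible_def using irreducible_iff_degree_eq_fdeg[of "f \<circ>\<^sub>p monom 1 t" y] assms d
    by auto
qed

text \<open>The root sets of the counted polynomials are disjoint, have \<open>m\<close> elements
  each and together form \<open>hyper_elements m t\<close>.\<close>

lemma N_star_eq:
  assumes "m > 0" "t > 0"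
  shows "N_star F m t * m = card (hyper_elements m t)"
proof -
  define A where "A = {f :: 'a poly. lead_coeff f = 1 \<and> degree f = m \<and> hyper_irreducible t f \<and> f \<noteq> [:0, 1:]}"
  define R where "R = (\<lambda>f :: 'a poly. {x. ac_eval f x = 0})"
  have A_nz: "f \<noteq> 0" if "f \<in> A" for f using that by (auto simp: A_def)
  have root: "x \<in> hyper_elements m t" if f: "f \<in> A" and x: "ac_eval f x = 0" for f x
  proof -
    have *: "fdeg y = m * t" if "y ^ t = x" for y
      using hyper_irreducible_iff[of f y t] that f x assms A_nz[OF f] by (auto simp: A_def)
    obtain y where "y ^ t = x" using nth_root_exists[of t x] assms by auto
    \<comment> \<open>The degree of \<open>x\<close> is squeezed: its \<open>t\<close>-th root has
      degree \<open>m * t\<close>, and \<open>x\<close> is a root of a polynomial of degree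
      \<open>m\<close>.\<close>
    hence "m * t \<le> t * fdeg x" using fdeg_root_le[of y t x] * assms by simp
    moreover have "fdeg x \<le> m" using fdeg_le_degree[OF A_nz[OF f] x] f by (simp add: A_def)
    ultimately have deg: "fdeg x = m" using assms by (simp add: mult.commute)
    have "x \<noteq> 0"
    proof
      assume x0: "x = 0"
      hence "fdeg x \<le> 1" using q_ge_2 by (intro fdeg_le) (auto simp: power_0_left)
      hence "m = 1" using deg assms by simp
      hence "lead_coeff f = 1" "degree f = 1" "coeff f 0 = 0"
        using f x x0 by (auto simp: A_def ac_eval_def poly_0_coeff_0 coeff_map_poly)
      hence "f = [:0, 1:]" 
        by (intro poly_eqI) (auto simp: coeff_pCons coeff_eq_0 split: nat.splits)
      thus False using f by (simp add: A_def)
    qed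
    thus ?thesis using * deg by (simp add: hyper_elements_def)
  qed
  have card_R: "card (R f) = m" and fin_R: "finite (R f)" if f: "f \<in> A" for f
  proof -
    have "degree f > 0" using f assms by (simp add: A_def)
    then obtain x where x: "ac_eval f x = 0" using ac_root_exists by blast
    show fin: "finite (R f)" unfolding R_def by (rule finite_ac_roots[OF A_nz[OF f]])
    have "card (conjugates x) \<le> card (R f)"
      using conjugates_subset_roots[OF x] fin unfolding R_def by (intro card_mono)
    moreover have "fdeg x = m" using root[OF f x] by (simp add: hyper_elements_def)
    moreover have "card (R f) \<le> m" using card_ac_roots_le[OF A_nz[OF f]] f by (simp add: R_def A_def)
    ultimately show "card (R f) = m" by (simp add: card_conjugates)
  qed
  have disj: "R f \<inter> R g = {}" if f: "f \<in> A" and g: "g \<in> A" and "f \<noteq> g" for f g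
  proof (rule ccontr)
    assume "R f \<inter> R g \<noteq> {}"
    then obtain x where x: "ac_eval f x = 0" "ac_eval g x = 0" by (auto simp: R_def)
    have "fdeg x = m" using root[OF f x(1)] by (simp add: hyper_elements_def)
    \<comment> \<open>Two monic polynomials of degree \<open>m\<close> differ by one of smaller
      degree, which cannot vanish at an element of degree \<open>m\<close>.\<close>
    moreover have "degree (f - g) < m"
    proof -
      have "degree (f - g) \<le> m" "coeff (f - g) m = 0"
        using f g by (auto simp: A_def intro: degree_diff_le)
      thus ?thesis
        using \<open>f \<noteq> g\<close> by (metis eq_iff_diff_eq_0 leading_coeff_0_iff order_le_less)
    qed
    moreover have "fdeg x \<le> degree (f - g)" using x \<open>f \<noteq> g\<close> by (intro fdeg_le_degree) auto
    ultimately show False by simp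
  qed
  have "hyper_elements m t = (\<Union>f\<in>A. R f)"
  proof (intro equalityI subsetI)
    fix x assume x: "x \<in> hyper_elements m t"
    obtain g :: "'a poly" where g: "lead_coeff g = 1" "degree g = fdeg x" "ac_eval g x = 0"
      using minimal_poly_exists .
    obtain y where y: "y ^ t = x" using nth_root_exists[of t x] assms by auto
    hence "fdeg y = m * t" "fdeg x = m" "x \<noteq> 0" using x by (auto simp: hyper_elements_def)
    moreover have "g \<noteq> 0" using g by auto
    ultimately have "hyper_irreducible t g" using hyper_irreducible_iff[of g y t] y g assms by simp
    moreover have "g \<noteq> [:0, 1:]" using g \<open>x \<noteq> 0\<close> by auto
    ultimately have "g \<in> A" using g \<open>fdeg x = m\<close> by (simp add: A_def)
    thus "x \<in> (\<Union>f\<in>A. R f)" using g by (auto simp: R_def)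
  qed (use root in \<open>auto simp: R_def\<close>)
  moreover have "card (\<Union>f\<in>A. R f) = (\<Sum>f\<in>A. card (R f))"
  proof (rule card_UN_disjoint)
    show "finite A"
    proof (rule finite_subset)
      show "A \<subseteq> Poly ` {xs. set xs \<subseteq> UNIV \<and> length xs \<le> Suc m}"
      proof
        fix f assume "f \<in> A"
        hence "length (coeffs f) \<le> Suc m"
          using length_coeffs_degree[OF A_nz[OF \<open>f \<in> A\<close>]] by (simp add: A_def)
        thus "f \<in> Poly ` {xs. set xs \<subseteq> UNIV \<and> length xs \<le> Suc m}"
          by (intro image_eqI[of _ _ "coeffs f"]) auto
      qed
    qed (intro finite_imageI finite_lists_length_le finite)
  qed (use fin_R disj in auto)
  ultimately have "card (hyper_elements m t) = card A * m" using card_R by simp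
  thus ?thesis by (simp add: N_star_def A_def)
qed

subsection \<open>Elements all of whose t-th roots have maximal degree\<close>

lemma fdeg_dvd_iff_power_eq_1:
  assumes "x \<noteq> 0"
  shows "fdeg x dvd n \<longleftrightarrow> x ^ (q ^ n - 1) = 1"
  using power_q_eq_self_iff[of x n] power_Suc_eq_self_iff[OF assms, of "q ^ n"] q_gt_0 by simp

text \<open>An \<open>s\<close>-th root of \<open>z\<close> is a full root of \<open>x\<close> of
  degree m s r, and taking it multiplies the degree of \<open>z\<close> by at most
  \<open>s\<close>.\<close>

lemma hyper_elements_root:
  assumes "x \<in> hyper_elements m (s * r)" "z ^ r = x" "s > 0"
  shows "m * r \<le> fdeg z"
proof -
  obtain y where y: "y ^ s = z" using nth_root_exists[of s z] assms by auto
  hence "y ^ (s * r) = x" using assms(2) by (simp add: power_mult)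
  hence "m * (s * r) = fdeg y" using assms(1) by (simp add: hyper_elements_def)
  also have "\<dots> \<le> s * fdeg z" using fdeg_root_le[OF y] assms by simp
  finally show ?thesis using assms(3) by (simp add: mult.left_commute)
qed

text \<open>A \<open>p\<close>-th root of \<open>x\<close> in the field with \<open>q ^ m\<close>
  elements would have degree at most \<open>m\<close>, less than the required \<open>m * p\<close>.
  Failure of either claim produces such a root.\<close>

lemma hyper_elements_imp_not_power:
  assumes x: "x \<in> hyper_elements m t" and "t > 0" and p: "prime p" "p dvd t"
  shows "p dvd q ^ m - 1" "x ^ ((q ^ m - 1) div p) \<noteq> 1"
proof -
  obtain s where t: "t = s * p" using p(2) by (metis dvdE mult.commute)
  have s: "s > 0" using t assms by (intro Nat.gr0I) auto
  have x0: "x \<noteq> 0" and m: "fdeg x = m" using x by (auto simp: hyper_elements_def)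
  have m0: "m > 0" using fdeg_pos[of x] m by simp
  have x1: "x ^ (q ^ m - 1) = 1" using fdeg_dvd_iff_power_eq_1[OF x0, of m] m by simp
  have no_root: False if "z ^ p = x" "z ^ (q ^ m - 1) = 1" for z
  proof -
    have "z \<noteq> 0" using that(1) x0 prime_gt_0_nat[OF p(1)] by (auto simp: power_0_left)
    hence "fdeg z dvd m" using that(2) fdeg_dvd_iff_power_eq_1 by blast
    hence "fdeg z \<le> m" using m0 by (rule dvd_imp_le)
    moreover have "m * p \<le> fdeg z" using hyper_elements_root[of x m s p z] x t that(1) s by simp
    moreover have "m * 2 \<le> m * p" using prime_ge_2_nat[OF p(1)] by simp
    ultimately show False using m0 by linarith
  qed
  show dvd: "p dvd q ^ m - 1"
  proof (rule ccontr)
    assume "\<not> p dvd q ^ m - 1"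
    hence "coprime p (q ^ m - 1)" using p(1) by (simp add: prime_imp_coprime)
    \<comment> \<open>With \<open>u\<close> inverse to \<open>p\<close> modulo
      \<open>q ^ m - 1\<close>, the element \<open>x ^ u\<close> is a \<open>p\<close>-th root of
      \<open>x\<close> in that field.\<close>
    then obtain u where u: "[p * u = 1] (mod (q ^ m - 1))" using cong_solve_coprime_nat by auto
    hence "(x ^ u) ^ p = x" using power_cong_exponent[OF x1 u] by (simp add: mult.commute flip: power_mult)
    moreover have "(x ^ u) ^ (q ^ m - 1) = 1" using x1 by (metis mult.commute power_mult power_one)
    ultimately show False using no_root by blast
  qed
  show "x ^ ((q ^ m - 1) div p) \<noteq> 1"
  proof
    assume *: "x ^ ((q ^ m - 1) div p) = 1"
    obtain z where z: "z ^ p = x" using nth_root_exists[of p x] prime_gt_0_nat[OF p(1)] by auto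
    have "z ^ (q ^ m - 1) = (z ^ p) ^ ((q ^ m - 1) div p)" using dvd by (simp flip: power_mult)
    thus False using no_root[OF z] * z by simp
  qed
qed

text \<open>
  If \<open>q ^ m\<close> is \<open>3\<close> modulo \<open>4\<close>, then every fourth root of \<open>x\<close> lies in the field with \<open>q ^ (2 * m)\<close>
  elements, hence has degree less than \<open>4 * m\<close>.
\<close>

lemma hyper_elements_imp_cong_4:
  assumes x: "x \<in> hyper_elements m t" and "t > 0" and "4 dvd t"
  shows "4 dvd q ^ m - 1"
proof (rule ccontr)
  assume n4: "\<not> 4 dvd q ^ m - 1"
  obtain s where t: "t = s * 4" using assms(3) by (metis dvdE mult.commute)
  have s: "s > 0" using t assms by (intro Nat.gr0I) auto
  have x0: "x \<noteq> 0" and m: "fdeg x = m" using x by (auto simp: hyper_elements_def)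
  have m0: "m > 0" using fdeg_pos[of x] m by simp
  have x1: "x ^ (q ^ m - 1) = 1" using fdeg_dvd_iff_power_eq_1[OF x0, of m] m by simp
  have "2 dvd q ^ m - 1" using hyper_elements_imp_not_power(1)[OF x assms(2), of 2] t by simp
  \<comment> \<open>So 4 (q^m - 1) divides q^(2m) - 1 = (q^m - 1)(q^m + 1), which places the fourth
    roots in the quadratic extension.\<close>
  moreover have "4 dvd n + 1" if "2 dvd n - 1" "\<not> 4 dvd n - 1" "n > 0" for n :: nat
    using that by presburger
  ultimately have "4 dvd q ^ m + 1" using n4 q_gt_0 by simp
  then obtain r where r: "q ^ m + 1 = 4 * r" ..
  obtain z where z: "z ^ 4 = x" using nth_root_exists[of 4 x] by auto
  have "q ^ (2 * m) = q ^ m * q ^ m" by (simp add: mult_2 power_add)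
  hence "q ^ (2 * m) - 1 = (q ^ m - 1) * (q ^ m + 1)"
    using q_gt_0 by (simp add: diff_mult_distrib add_mult_distrib2)
  hence "z ^ (q ^ (2 * m) - 1) = ((z ^ 4) ^ (q ^ m - 1)) ^ r"
    unfolding r by (simp add: mult_ac flip: power_mult)
  hence "z ^ (q ^ (2 * m) - 1) = 1" using x1 z by simp
  moreover have "z \<noteq> 0" using z x0 by auto
  ultimately have "fdeg z dvd 2 * m" using fdeg_dvd_iff_power_eq_1 by blast
  hence "fdeg z \<le> 2 * m" using m0 by (intro dvd_imp_le) auto
  moreover have "m * 4 \<le> fdeg z" using hyper_elements_root[of x m s 4 z] x t z s by simp
  ultimately show False using m0 by linarith
qed

text \<open>Write fdeg y = m k, Q = q^m and w = y^(Q-1). Then w^t = x^(Q-1) = 1, while w^(t/r) =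
  x^((Q-1)/r) is not 1 for primes r dividing \<open>t\<close>. Since w^S = 1 for the geometric sum S
  with \<open>k\<close> terms, the full \<open>r\<close>-part of \<open>t\<close> divides S, and
  lifting the exponent carries it over to \<open>k\<close>.\<close>

lemma fdeg_root_eq:
  assumes x: "x \<noteq> 0" "fdeg x = m" and t: "t > 0" and y: "y ^ t = x"
    and p: "\<And>p. prime p \<Longrightarrow> p dvd t \<Longrightarrow> p dvd q ^ m - 1 \<and> x ^ ((q ^ m - 1) div p) \<noteq> 1"
    and 4: "4 dvd t \<longrightarrow> 4 dvd q ^ m - 1"
  shows "fdeg y = m * t"
proof -
  have y0: "y \<noteq> 0" using x y t by (auto simp: power_0_left)
  have "x ^ (q ^ fdeg y) = x" unfolding y[symmetric] by (metis mult.commute power_fdeg power_mult)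
  hence "m dvd fdeg y" using power_q_eq_self_iff[of x] x by simp
  then obtain k where k: "fdeg y = m * k" ..
  define Q where "Q = q ^ m"
  have Q0: "Q > 0" by (simp add: Q_def q_gt_0)
  define S where "S = (\<Sum>i<k. Q ^ i)"
  define w where "w = y ^ (Q - 1)"
  have k0: "k > 0" using k fdeg_pos[of y] by (intro Nat.gr0I) auto
  have "y ^ (q ^ fdeg y - 1) = 1" using fdeg_dvd_iff_power_eq_1[OF y0, of "fdeg y"] by simp
  moreover have "(Q - 1) * S = q ^ fdeg y - 1"
    by (simp only: S_def geometric_sum_nat) (simp only: Q_def k power_mult)
  ultimately have wS: "w ^ S = 1" by (simp only: w_def flip: power_mult)
  have x1: "x ^ (Q - 1) = 1" using fdeg_dvd_iff_power_eq_1[OF x(1), of m] x(2) by (simp add: Q_def)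
  have "t dvd k"
  proof (rule multiplicity_le_imp_dvd)
    fix r :: nat assume r: "prime r"
    define b where "b = multiplicity r t"
    show "multiplicity r t \<le> multiplicity r k"
    proof (cases "b = 0")
      case False
      have dvd: "r dvd t" using False by (metis b_def not_dvd_imp_multiplicity_0)
      have rQ: "r dvd Q - 1" "x ^ ((Q - 1) div r) \<noteq> 1" using p[OF r dvd] by (auto simp: Q_def)
      obtain t' where t': "t = r ^ b * t'" by (metis b_def dvdE multiplicity_dvd)
      obtain u where u: "Q - 1 = r * u" using rQ(1) ..
      have "r ^ b dvd S"
      proof (cases "S = 0")
        case False
        define c where "c = multiplicity r S"
        obtain s where s: "S = r ^ c * s" "\<not> r dvd s"
          using multiplicity_decompose'[OF False, of r] r c_def by (metis prime_elem_not_unit prime_imp_prime_elem)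
        \<comment> \<open>Otherwise z = w^(t/r) has both \<open>z ^ s = 1\<close> and
          \<open>z ^ r = 1\<close> with \<open>r\<close>, \<open>s\<close> coprime, so z = 1,
          although z = x^((Q-1)/r).\<close>
        have "b \<le> c"
        proof (rule ccontr)
          assume "\<not> b \<le> c"
          hence bc: "b - 1 = c + (b - 1 - c)" by simp
          define z where "z = w ^ (r ^ (b - 1) * t')"
          have "w ^ (r ^ (b - 1) * t' * s) = (w ^ S) ^ (r ^ (b - 1 - c) * t')"
            by (subst bc, simp add: s(1) power_add mult_ac flip: power_mult)
          hence zs: "z ^ s = 1" by (simp add: z_def wS flip: power_mult)
          have "z ^ r = w ^ t"
            using \<open>b \<noteq> 0\<close> by (cases b) (simp_all add: z_def t' mult_ac flip: power_mult)
          also have "\<dots> = (y ^ t) ^ (Q - 1)" by (simp add: w_def mult.commute flip: power_mult)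
          finally have zr: "z ^ r = 1" by (simp only: y x1)
          have "coprime r s" using r s(2) by (simp add: prime_imp_coprime)
          hence "z = 1" using power_coprime_eq_1[OF zr zs] by blast
          moreover have "z = (y ^ t) ^ u"
            unfolding z_def w_def u t'
            using \<open>b \<noteq> 0\<close> by (cases b) (simp_all add: mult_ac flip: power_mult)
          moreover have "u = (Q - 1) div r" using u prime_gt_0_nat[OF r] by simp
          ultimately show False using rQ(2) y by simp
        qed
        thus ?thesis by (simp add: s(1) le_imp_power_dvd)
      qed simp
      moreover have "[Q = 1] (mod r)"
        using rQ(1) Q0 by (metis One_nat_def Suc_leI cong_altdef_nat)
      moreover have "r = 2 \<and> b \<ge> 2 \<longrightarrow> [Q = 1] (mod 4)"
      proof
        assume "r = 2 \<and> b \<ge> 2"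
        hence "2 ^ 2 dvd t" by (metis b_def multiplicity_dvd')
        hence "4 dvd Q - 1" using 4 by (simp add: Q_def)
        thus "[Q = 1] (mod 4)" using Q0 by (metis One_nat_def Suc_leI cong_altdef_nat)
      qed
      ultimately have "r ^ b dvd k"
        unfolding S_def using prime_power_dvd_geometric_sum[OF r] by blast
      thus ?thesis using k0 r by (intro multiplicity_geI) (auto simp: b_def)
    qed (simp add: b_def)
  qed (use t in simp)
  hence "m * t \<le> fdeg y" using k k0 by (simp add: dvd_imp_le)
  moreover have "fdeg y \<le> m * t" using fdeg_root_le[OF y t] x(2) by (simp add: mult.commute)
  ultimately show ?thesis by simp
qed

end

section \<open>Counting\<close>

lemma prod_pairwise_coprime_dvd:
  assumes "finite D" "\<And>p. p \<in> D \<Longrightarrow> p dvd (n :: nat)" "\<And>p r. p \<in> D \<Longrightarrow> r \<in> D \<Longrightarrow> p \<noteq> r \<Longrightarrow> coprime p r"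
  shows "\<Prod>D dvd n"
  using assms
proof (induction D rule: finite_induct)
  case (insert p D)
  hence "coprime p (\<Prod>D)" by (intro prod_coprime_right) auto
  thus ?case using insert by (simp add: divides_mult)
qed simp

context finite_field_primepow
begin

text \<open>In characteristic dividing \<open>q\<close> this number is -1; it supplies the
  invertibility needed to count roots of unity.\<close>

lemma of_nat_q_power_diff_1_nz:
  assumes "d > 0"
  shows "of_nat (q ^ d - 1) \<noteq> (0 :: 'a alg_closure)"
proof -
  have "of_nat q = (0 :: 'a)" using of_nat_CARD_eq_0[where 'a='a] CARD_eq by simp
  hence "to_ac (of_nat q :: 'a) = 0" by simp
  hence "of_nat q = (0 :: 'a alg_closure)" by (simp only: to_ac_of_nat)
  hence "of_nat (q ^ d - 1) = (- 1 :: 'a alg_closure)"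
    using assms q_gt_0 by (simp add: of_nat_diff Suc_leI power_0_left)
  thus ?thesis by simp
qed

text \<open>If all primes \<open>p\<close> dividing \<open>t\<close> divide
  \<open>q ^ m - 1\<close>, these are the nonzero elements of the field with \<open>q ^ m\<close>
  elements that are \<open>p\<close>-th powers there for no such \<open>p\<close>, by Euler's
  criterion.\<close>

definition non_powers :: "nat \<Rightarrow> nat \<Rightarrow> 'a alg_closure set" where
  "non_powers m t = {x. x \<noteq> 0 \<and> fdeg x dvd m \<and> (\<forall>p\<in>prime_factors t. x ^ ((q ^ m - 1) div p) \<noteq> 1)}"

text \<open>Subfield elements satisfy x^R = 1, where q^m - 1 = R M. If a prime \<open>p\<close>
  divides \<open>t\<close> and M, then x^(R M/p) = 1 for all of them. If M is coprime to
  \<open>t\<close>, the condition becomes that x^(R/p) is not 1, and the product over the primes is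
  totient(t) / t.\<close>

lemma card_non_powers_subfield:
  assumes m: "m > 0" and t: "t > 0" and j: "j dvd m"
    and p: "\<And>p. p \<in> prime_factors t \<Longrightarrow> p dvd q ^ m - 1"
  shows "real (card {x \<in> non_powers m t. fdeg x dvd m div j}) =
    (if gcd ((q ^ m - 1) div (q ^ (m div j) - 1)) t = 1
     then real (totient t) / real t * (real q ^ (m div j) - 1) else 0)"
proof -
  define d where "d = m div j"
  obtain l where l: "m = j * l" using j ..
  have d: "d > 0" "d dvd m" using m by (auto simp: d_def l)
  define R where "R = q ^ d - 1"
  define M where "M = (q ^ m - 1) div R"
  have R0: "R > 0" using d(1) q_ge_2 one_less_power[of q d] by (simp add: R_def)
  obtain k where k: "m = d * k" using d(2) ..
  have "R dvd q ^ m - 1"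
    unfolding R_def k power_mult using geometric_sum_nat[of "q ^ d" k] by (metis dvd_triv_left)
  hence Q: "q ^ m - 1 = R * M" by (simp add: M_def)
  have mem: "x \<in> non_powers m t \<and> fdeg x dvd d \<longleftrightarrow>
      x ^ R = 1 \<and> (\<forall>p\<in>prime_factors t. x ^ (R * M div p) \<noteq> 1)" for x
  proof -
    have "x \<noteq> 0 \<and> fdeg x dvd d \<longleftrightarrow> x ^ R = 1"
      using fdeg_dvd_iff_power_eq_1[of x d] R0 by (cases "x = 0") (auto simp: R_def power_0_left)
    thus ?thesis using d(2) unfolding non_powers_def Q by (auto intro: dvd_trans)
  qed
  show ?thesis
  proof (cases "gcd M t = 1")
    case True
    have pR: "p dvd R \<and> coprime M p" if "p \<in> prime_factors t" for p
    proof -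
      have "p dvd t" "prime p" using that by auto
      hence "coprime M p" using True by (meson coprime_divisors coprime_iff_gcd_eq_1 dvd_refl)
      moreover have "p dvd R * M" using p[OF that] Q by simp
      ultimately show ?thesis by (simp add: coprime_commute coprime_dvd_mult_left_iff)
    qed
    have "x ^ (R * M div p) = 1 \<longleftrightarrow> x ^ (R div p) = 1" if p: "p \<in> prime_factors t" and x: "x ^ R = 1"
      for x :: "'a alg_closure" and p
    proof -
      have "R * M div p = (R div p) * M" using pR[OF p] by (simp add: div_mult_swap mult.commute)
      moreover have "(x ^ (R div p)) ^ p = 1" using pR[OF p] x by (simp flip: power_mult)
      ultimately show ?thesis
        using pR[OF p] power_coprime_eq_1[of "x ^ (R div p)" M p] by (auto simp: power_mult)
    qed
    hence "{x \<in> non_powers m t. fdeg x dvd d} = {x. x ^ R = 1 \<and> (\<forall>p\<in>prime_factors t. x ^ (R div p) \<noteq> 1)}"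
      using mem by auto
    moreover have "\<Prod>(prime_factors t) dvd R"
      
      using pR by (intro prod_pairwise_coprime_dvd) (auto intro: primes_coprime)
    moreover have "of_nat R \<noteq> (0 :: 'a alg_closure)"
      unfolding R_def by (rule of_nat_q_power_diff_1_nz[OF d(1)])
    ultimately have "real (card {x \<in> non_powers m t. fdeg x dvd d})
        = real R * (\<Prod>p\<in>prime_factors t. 1 - 1 / real p)"
      using card_roots_of_unity_avoiding[of "prime_factors t" R, where 'a = "'a alg_closure"] by auto
    also have "\<dots> = real (totient t) / real t * real R"
      using t by (simp add: totient_formula2)
    also have "real R = real q ^ d - 1"
      using q_gt_0 by (simp add: R_def of_nat_diff Suc_leI)
    finally show ?thesis using True by (simp add: d_def M_def R_def)
  next
    case False
    then obtain p where pp: "prime p" "p dvd M" "p dvd t"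
      by (metis gcd_dvd1 gcd_dvd2 dvd_trans prime_factor_nat)
    hence pt: "p \<in> prime_factors t" using t by (simp add: prime_factors_dvd)
    have "R * M div p = R * (M div p)" using pp(2) by (simp add: div_mult_swap)
    hence "x ^ R = 1 \<Longrightarrow> x ^ (R * M div p) = 1" for x :: "'a alg_closure" by (simp add: power_mult)
    hence "{x \<in> non_powers m t. fdeg x dvd d} = {}" using mem pt by blast
    hence "real (card {x \<in> non_powers m t. fdeg x dvd d}) = 0" by (simp only: card.empty of_nat_0)
    thus ?thesis using False unfolding M_def R_def d_def by (simp only: if_False)
  qed
qed

text \<open>A single element of the set forces the divisibility conditions on \<open>q\<close>,
  \<open>m\<close> and \<open>t\<close>; then only the condition on \<open>p\<close>-th powers
  depends on \<open>x\<close>.\<close>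

lemma hyper_elements_eq:
  assumes "hyper_elements m t \<noteq> {}" "t > 0"
  shows "hyper_elements m t = {x \<in> non_powers m t. fdeg x = m}"
proof -
  obtain a where a: "a \<in> hyper_elements m t" using assms(1) by blast
  have "x \<in> hyper_elements m t" if x: "x \<in> non_powers m t" "fdeg x = m" for x
  proof -
    have "fdeg y = m * t" if "y ^ t = x" for y
    proof (rule fdeg_root_eq[OF _ x(2) assms(2) that])
      fix p assume "prime p" "p dvd t"
      thus "p dvd q ^ m - 1 \<and> x ^ ((q ^ m - 1) div p) \<noteq> 1"
        using x(1) hyper_elements_imp_not_power(1)[OF a assms(2)] assms(2)
        by (auto simp: non_powers_def prime_factors_dvd)
    qed (use x(1) hyper_elements_imp_cong_4[OF a assms(2)] in \<open>auto simp: non_powers_def\<close>)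
    thus ?thesis using x by (simp add: hyper_elements_def non_powers_def)
  qed
  moreover have "x \<in> non_powers m t" "fdeg x = m" if "x \<in> hyper_elements m t" for x
    using that hyper_elements_imp_not_power(2)[OF that assms(2)]
    by (auto simp: hyper_elements_def non_powers_def)
  ultimately show ?thesis by blast
qed

lemma finite_non_powers:
  assumes "m > 0"
  shows "finite (non_powers m t)"
proof (rule finite_subset)
  show "non_powers m t \<subseteq> {x. x ^ (q ^ m - 1) = 1}"
    using fdeg_dvd_iff_power_eq_1 by (auto simp: non_powers_def)
  have "q ^ m - 1 > 0" using assms q_ge_2 one_less_power[of q m] by simp
  thus "finite {x :: 'a alg_closure. x ^ (q ^ m - 1) = 1}"
    using card_roots_of_unity[OF of_nat_q_power_diff_1_nz[OF assms]] by (intro card_ge_0_finite) simp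
qed

text \<open>After exchanging the sums, an \<open>x\<close> with m = k fdeg(x) meets exactly the
  \<open>j\<close> dividing \<open>k\<close>, so the inner Moebius sum singles out k = 1.\<close>

lemma moebius_inversion_fdeg:
  assumes "finite A" "m > 0" "\<And>x. x \<in> A \<Longrightarrow> fdeg x dvd m"
  shows "int (card {x \<in> A. fdeg x = m}) = (\<Sum>j | j dvd m. moebius_mu j * int (card {x \<in> A. fdeg x dvd m div j}))"
proof -
  have "(\<Sum>j | j dvd m. moebius_mu j * int (card {x \<in> A. fdeg x dvd m div j}))
      = (\<Sum>j | j dvd m. \<Sum>x\<in>A. if fdeg x dvd m div j then moebius_mu j else 0)"
    using assms(1) by (intro sum.cong refl) (simp add: mult.commute flip: sum.inter_filter)
  also have "\<dots> = (\<Sum>x\<in>A. \<Sum>j | j dvd m. if fdeg x dvd m div j then moebius_mu j else 0)"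
    by (rule sum.swap)
  also have "\<dots> = (\<Sum>x\<in>A. if fdeg x = m then 1 else 0)"
  proof (rule sum.cong[OF refl])
    fix x assume x: "x \<in> A"
    obtain k where k: "m = fdeg x * k" using assms(3)[OF x] ..
    have k0: "k > 0" "fdeg x > 0" using k assms(2) by auto
    have "{j. j dvd m \<and> fdeg x dvd m div j} = {j. j dvd k}"
    proof (intro Collect_cong iffI)
      fix j assume "j dvd m \<and> fdeg x dvd m div j"
      then obtain l where "m = j * (fdeg x * l)" by (metis dvdE dvd_mult_div_cancel)
      hence "k = j * l" using k k0 by (simp add: mult.left_commute)
      thus "j dvd k" by simp
    next
      fix j assume "j dvd k"
      thus "j dvd m \<and> fdeg x dvd m div j" using k k0 by (auto simp: div_mult_swap[symmetric])
    qed
    hence "(\<Sum>j | j dvd m. if fdeg x dvd m div j then moebius_mu j else 0) = (\<Sum>j | j dvd k. moebius_mu j)"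
      using assms(2) by (simp flip: sum.inter_filter)
    also have "\<dots> = (if k = 1 then 1 else 0)" by (rule sum_moebius_mu_divisors[OF k0(1)])
    also have "\<dots> = (if fdeg x = m then 1 else 0)" using k k0 by simp
    finally show "(\<Sum>j | j dvd m. if fdeg x dvd m div j then moebius_mu j else 0) = (if fdeg x = m then 1 else 0)" .
  qed
  also have "\<dots> = int (card {x \<in> A. fdeg x = m})"
    using assms(1) by (simp flip: sum.inter_filter)
  finally show ?thesis by simp
qed

section \<open>Exact count and upper bound when some hyper-irreducible polynomial exists\<close>

context
  fixes m t :: nat
  assumes m: "m > 0" and t: "t > 0" and N_nz: "N_star F m t \<noteq> 0"
begin

lemma hyper_elements_nonempty: "hyper_elements m t \<noteq> {}"
  using N_star_eq[OF m t] N_nz m by auto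

lemma prime_factor_dvd_q_power_diff_1:
  assumes "p \<in> prime_factors t"
  shows "p dvd q ^ m - 1"
proof -
  obtain a where "a \<in> hyper_elements m t" using hyper_elements_nonempty by blast
  thus ?thesis using hyper_elements_imp_not_power(1)[of a m t p] t assms by auto
qed

lemma N_star_mult_eq:
  "real (N_star F m t) * real m = real (totient t) / real t *
    (\<Sum>j | j \<ge> 1 \<and> j dvd m \<and> gcd ((q ^ m - 1) div (q ^ (m div j) - 1)) t = 1.
      real_of_int (moebius_mu j) * (real q ^ (m div j) - 1))"
    (is "_ = ?c * sum ?f ?J")
proof -
  have "int (N_star F m t * m) = int (card {x \<in> non_powers m t. fdeg x = m})"
    using N_star_eq[OF m t] hyper_elements_eq[OF hyper_elements_nonempty t] by simp
  also have "\<dots> = (\<Sum>j | j dvd m. moebius_mu j * int (card {x \<in> non_powers m t. fdeg x dvd m div j}))"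
    by (rule moebius_inversion_fdeg[OF finite_non_powers[OF m] m]) (simp add: non_powers_def)
  finally have "real_of_int (int (N_star F m t * m)) = real_of_int \<dots>" by simp
  hence "real (N_star F m t) * real m =
      (\<Sum>j | j dvd m. real_of_int (moebius_mu j) * real (card {x \<in> non_powers m t. fdeg x dvd m div j}))"
    by simp
  also have "\<dots> = (\<Sum>j | j dvd m. if j \<in> ?J then ?c * ?f j else 0)"
  proof (rule sum.cong[OF refl])
    fix j assume "j \<in> {j. j dvd m}"
    hence j: "j dvd m" by simp
    moreover have "j \<ge> 1" using j m by (metis dvd_pos_nat Suc_leI One_nat_def)
    ultimately show "real_of_int (moebius_mu j) * real (card {x \<in> non_powers m t. fdeg x dvd m div j})
        = (if j \<in> ?J then ?c * ?f j else 0)"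
      using card_non_powers_subfield[OF m t j prime_factor_dvd_q_power_diff_1] by simp
  qed
  also have "\<dots> = (\<Sum>j\<in>?J. ?c * ?f j)"
    using m by (subst sum.inter_filter[symmetric]) (auto intro!: sum.cong)
  finally show ?thesis by (simp add: sum_distrib_left)
qed

text \<open>Drop the condition \<open>fdeg x = m\<close> and count in the whole field, the case
  \<open>j = 1\<close>, where the quotient is 1 and hence coprime to \<open>t\<close>.\<close>

lemma N_star_mult_le: "real (N_star F m t) * real m \<le> real (totient t) / real t * (real q ^ m - 1)"
proof -
  have "real (N_star F m t) * real m = real (card {x \<in> non_powers m t. fdeg x = m})"
    using N_star_eq[OF m t] hyper_elements_eq[OF hyper_elements_nonempty t] by (metis of_nat_mult)
  also have "\<dots> \<le> real (card {x \<in> non_powers m t. fdeg x dvd m div 1})"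
    using finite_non_powers[OF m] by (intro of_nat_mono card_mono) auto
  also have "\<dots> = real (totient t) / real t * (real q ^ m - 1)"
    using card_non_powers_subfield[of m t 1] m t prime_factor_dvd_q_power_diff_1
      one_less_power[of q m] q_ge_2 by simp
  finally show ?thesis .
qed

end

end

section \<open>Combining the count with the estimates\<close>

theorem theorem1p3:
  fixes q m t :: nat
  assumes "primepow q"
    and "CARD('a::finite_field) = q"
    and "m \<ge> 1" and "t \<ge> 1"
    and "N_star TYPE('a) m t \<noteq> 0"
  shows "real (N_star TYPE('a) m t) =
           real (totient t) / (real m * real t) *
           (\<Sum>j \<in> {j. j \<ge> 1 \<and> j dvd m \<and> gcd ((q ^ m - 1) div (q ^ (m div j) - 1)) t = 1}.
              real_of_int (moebius_mu j) * (real q ^ (m div j) - 1))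
       \<and> real (totient t) * (real q ^ m - 1) / (real t * (real m + 1)) \<le> real (N_star TYPE('a) m t)
       \<and> real (N_star TYPE('a) m t) \<le> real (totient t) * (real q ^ m - 1) / (real t * real m)"
proof -
  interpret finite_field_primepow "TYPE('a)" q
    using assms by unfold_locales auto
  have m: "m > 0" and t: "t > 0" using assms by auto
  define N where "N = real (N_star TYPE('a) m t)"
  define c where "c = real (totient t) / real t"
  define J where "J = {j. j \<ge> 1 \<and> j dvd m \<and> gcd ((q ^ m - 1) div (q ^ (m div j) - 1)) t = 1}"
  define S where "S = (\<Sum>j\<in>J. real_of_int (moebius_mu j) * (real q ^ (m div j) - 1))"
  have N: "N * real m = c * S"
    using N_star_mult_eq[OF m t assms(5)] by (simp only: N_def c_def S_def J_def)
  have upper: "N * real m \<le> c * (real q ^ m - 1)"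
    using N_star_mult_le[OF m t assms(5)] by (simp only: N_def c_def)
  have "real m * (real q ^ m - 1) \<le> (real m + 1) * S"
    unfolding S_def
  proof (rule sum_moebius_mu_powers_ge[OF q_ge_2 m])
    show "1 \<in> J" using one_less_power[of q m] q_ge_2 m by (simp add: J_def)
  next
    \<comment> \<open>For \<open>j\<close> = 2, 3, 6 the quotients are 63/7 = 9, 63/3 = 21 and 63/1
      = 63, and 63 divides 9 * 21.\<close>
    assume *: "q = 2" "m = 6" "2 \<in> J" "3 \<in> J"
    hence "coprime 9 t" "coprime 21 t" by (simp_all add: J_def coprime_iff_gcd_eq_1)
    hence "coprime (9 * 21) t" by (simp only: coprime_mult_left_iff)
    moreover have "(63 :: nat) dvd 9 * 21" by simp
    ultimately have "coprime 63 t" by (rule coprime_divisors[OF _ dvd_refl, rotated])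
    thus "6 \<in> J" using * by (simp add: J_def coprime_iff_gcd_eq_1)
  qed (auto simp: J_def)
  hence "c * (real m * (real q ^ m - 1)) \<le> c * ((real m + 1) * S)"
    by (rule mult_left_mono) (simp add: c_def)
  also have "\<dots> = real m * (N * (real m + 1))" using N by (simp add: algebra_simps)
  finally have "real m * (c * (real q ^ m - 1)) \<le> real m * (N * (real m + 1))"
    by (simp only: mult.left_commute)
  hence "c * (real q ^ m - 1) \<le> N * (real m + 1)" using m by simp
  hence "c * (real q ^ m - 1) / (real m + 1) \<le> N" by (simp add: divide_le_eq)
  moreover have "N \<le> c * (real q ^ m - 1) / real m" using upper m by (simp add: le_divide_eq)
  moreover have "N = c / real m * S" using N m by (simp add: eq_divide_eq)
  ultimately show ?thesis
    unfolding S_def[symmetric] J_def[symmetric] N_def[symmetric]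
    by (simp add: c_def S_def mult.commute)
qed

end
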